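(* Let $F_A$ be the free group on a finite set $A$ with $|A| > 2$ and let $\varphi \in \mathrm{Aut}(F_A)$. Then the following conditions are equivalent: (i) $\varphi$ satisfies a Lipschitz condition for every visual metric $d \in V^{A'}(p,\gamma,T)$ on $F_A$, where $A'$ is a basis of $F_A$ (for every basis $A'$ and all $p\in F_A$, $\gamma>0$, $T\geq 1$); (ii) $\varphi \in \mathrm{Inn}(F_A)$.
   Context: Maps are written on the right; $\mathrm{Inn}(F_A)$ is the group of inner automorphisms of $F_A$. A basis of $F_A$ is a free generating set. For a basis $A'$ of $G=F_A$, $d_{A'}$ denotes the word metric on $G$ with respect to $A'\cup A'^{-1}$. Gromov product: $(g|h)_p^{A'} = \frac12(d_{A'}(p,g)+d_{A'}(p,h)-d_{A'}(g,h))$. Let $\rho^{A'}_{p,\gamma}(g,h) = e^{-\gamma (g|h)_p^{A'}}$ if $g \ne h$ and $0$ otherwise. For $p \in G$, $\gamma>0$, $T\ge 1$, $V^{A'}(p,\gamma,T)$ is the set of all metrics $d$ on $G$ with $\frac1T\rho^{A'}_{p,\gamma}(g,h) \le d(g,h) \le T\rho^{A'}_{p,\gamma}(g,h)$ for all distinct $g,h\in G$; its elements are visual metrics. $\varphi$ satisfies a Lipschitz condition for $d$ if there is $K>0$ with $d(g\varphi,h\varphi)\le K\,d(g,h)$ for all $g,h\in G$. *)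

theory Defs
  imports "HOL-Algebra.Bij" "HOL-Analysis.Abstract_Metric_Spaces"
begin

section \<open>The free group on a set\<close>

text \<open>
  A letter is a pair of a generator and a sign: \<open>(a, True)\<close> stands for $a$ and
  \<open>(a, False)\<close> for its formal inverse.
\<close>

fun inv_letter :: "'a \<times> bool \<Rightarrow> 'a \<times> bool" where
  "inv_letter (a, s) = (a, \<not> s)"

definition reduced :: "('a \<times> bool) list \<Rightarrow> bool" where
  "reduced = successively (\<lambda>x y. y \<noteq> inv_letter x)"

text \<open>Left multiplication of a reduced word by a letter, with cancellation.\<close>

fun cons_letter :: "'a \<times> bool \<Rightarrow> ('a \<times> bool) list \<Rightarrow> ('a \<times> bool) list" where
  "cons_letter x [] = [x]"
| "cons_letter x (y # w) = (if y = inv_letter x then w else x # y # w)"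

definition free_group :: "'a set \<Rightarrow> ('a \<times> bool) list monoid" where
  "free_group A =
    \<lparr>carrier = {w \<in> lists (A \<times> UNIV). reduced w},
     mult = (\<lambda>u v. foldr cons_letter u v),
     one = []\<rparr>"

fun eval_letter :: "('g, 'm) monoid_scheme \<Rightarrow> 'g \<times> bool \<Rightarrow> 'g" where
  "eval_letter G (b, s) = (if s then b else inv\<^bsub>G\<^esub> b)"

definition eval_word :: "('g, 'm) monoid_scheme \<Rightarrow> ('g \<times> bool) list \<Rightarrow> 'g" where
  "eval_word G w = foldr (\<lambda>x g. eval_letter G x \<otimes>\<^bsub>G\<^esub> g) w \<one>\<^bsub>G\<^esub>"

text \<open>
  A basis is a free generating set: the canonical map from the free group on \<open>B\<close> to \<open>G\<close>
  is an isomorphism.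
\<close>

definition is_basis :: "('g, 'm) monoid_scheme \<Rightarrow> 'g set \<Rightarrow> bool" where
  "is_basis G B \<longleftrightarrow> B \<subseteq> carrier G \<and> eval_word G \<in> iso (free_group B) G"

text \<open>
  As for \<^const>\<open>auto\<close>, the elements are extensional functions. Since maps act on the right, the inner
  automorphism given by \<open>a\<close> sends $g$ to $a^{-1} g a$.
\<close>

definition Inn :: "('g, 'm) monoid_scheme \<Rightarrow> ('g \<Rightarrow> 'g) set" where
  "Inn G = (\<lambda>a. \<lambda>g\<in>carrier G. inv\<^bsub>G\<^esub> a \<otimes>\<^bsub>G\<^esub> g \<otimes>\<^bsub>G\<^esub> a) ` carrier G"

section \<open>Visual metrics\<close>

text \<open>
  The word metric is the path metric of the Cayley graph whose edges are $g$ -- $gs$ with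
  $s \in S \cup S^{-1}$; it is left invariant.
\<close>

definition word_dist :: "('g, 'm) monoid_scheme \<Rightarrow> 'g set \<Rightarrow> 'g \<Rightarrow> 'g \<Rightarrow> nat" where
  "word_dist G S g h =
    (LEAST n. \<exists>w \<in> lists (S \<times> UNIV). length w = n \<and> g \<otimes>\<^bsub>G\<^esub> eval_word G w = h)"

definition gromov_product ::
    "('g, 'm) monoid_scheme \<Rightarrow> 'g set \<Rightarrow> 'g \<Rightarrow> 'g \<Rightarrow> 'g \<Rightarrow> real" where
  "gromov_product G S p g h =
    (real (word_dist G S p g) + real (word_dist G S p h) - real (word_dist G S g h)) / 2"

definition visual_rho ::
    "('g, 'm) monoid_scheme \<Rightarrow> 'g set \<Rightarrow> 'g \<Rightarrow> real \<Rightarrow> 'g \<Rightarrow> 'g \<Rightarrow> real" where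
  "visual_rho G S p \<gamma> g h = (if g \<noteq> h then exp (- \<gamma> * gromov_product G S p g h) else 0)"

definition visual_metrics ::
    "('g, 'm) monoid_scheme \<Rightarrow> 'g set \<Rightarrow> 'g \<Rightarrow> real \<Rightarrow> real \<Rightarrow> ('g \<Rightarrow> 'g \<Rightarrow> real) set" where
  "visual_metrics G S p \<gamma> T =
    {d. Metric_space (carrier G) d \<and>
        (\<forall>g \<in> carrier G. \<forall>h \<in> carrier G. g \<noteq> h \<longrightarrow>
          1 / T * visual_rho G S p \<gamma> g h \<le> d g h \<and> d g h \<le> T * visual_rho G S p \<gamma> g h)}"

definition lipschitz_condition :: "'g set \<Rightarrow> ('g \<Rightarrow> 'g \<Rightarrow> real) \<Rightarrow> ('g \<Rightarrow> 'g) \<Rightarrow> bool" where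
  "lipschitz_condition X d f \<longleftrightarrow> (\<exists>K>0. \<forall>g\<in>X. \<forall>h\<in>X. d (f g) (f h) \<le> K * d g h)"

section \<open>Well-definedness\<close>

lemma inv_letter_inv_letter [simp]: "inv_letter (inv_letter x) = x"
  by (cases x) auto

lemma reduced_Nil [simp]: "reduced []"
  by (simp add: reduced_def)

lemma reduced_Cons: "reduced (x # w) \<longleftrightarrow> w = [] \<or> hd w \<noteq> inv_letter x \<and> reduced w"
  by (auto simp: reduced_def successively_Cons)

lemma reduced_cons_letter: "reduced w \<Longrightarrow> reduced (cons_letter x w)"
  by (cases w) (auto simp: reduced_Cons)

lemma cons_letter_cancel:
  assumes "reduced w"
  shows "cons_letter (inv_letter x) (cons_letter x w) = w"
proof (cases w)
  case (Cons y v)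
  then show ?thesis using assms by (cases v) (auto simp: reduced_Cons)
qed simp

lemma reduced_foldr: "reduced v \<Longrightarrow> reduced (foldr cons_letter u v)"
  by (induction u) (auto intro: reduced_cons_letter)

lemma lists_foldr:
  "u \<in> lists (A \<times> UNIV) \<Longrightarrow> v \<in> lists (A \<times> UNIV) \<Longrightarrow> foldr cons_letter u v \<in> lists (A \<times> UNIV)"
proof (induction u)
  case (Cons x u)
  then show ?case by (cases "foldr cons_letter u v") auto
qed simp

lemma foldr_cons_letter_assoc:
  assumes "reduced w"
  shows "foldr cons_letter (foldr cons_letter u v) w = foldr cons_letter u (foldr cons_letter v w)"
proof (induction u)
  case (Cons x u)
  have *: "foldr cons_letter (cons_letter x v) w = cons_letter x (foldr cons_letter v w)" for v
  proof (cases v)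
    case (Cons y t)
    then show ?thesis
      using cons_letter_cancel[OF reduced_foldr[OF assms], of "inv_letter x" t] by auto
  qed simp
  show ?case by (simp add: * Cons)
qed simp

lemma foldr_cons_letter_Nil: "reduced w \<Longrightarrow> foldr cons_letter w [] = w"
proof (induction w)
  case (Cons x w)
  then show ?case by (cases w) (auto simp: reduced_Cons)
qed simp

lemma foldr_rev_inv:
  "reduced v \<Longrightarrow> foldr cons_letter (map inv_letter (rev w)) (foldr cons_letter w v) = v"
proof (induction w arbitrary: v)
  case (Cons x w)
  then show ?case by (simp add: cons_letter_cancel reduced_foldr)
qed simp

lemma group_free_group: "group (free_group A)"
proof (rule groupI)
  fix x assume x: "x \<in> carrier (free_group A)"
  let ?y = "foldr cons_letter (map inv_letter (rev x)) []"
  have "map inv_letter (rev x) \<in> lists (A \<times> UNIV)"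
    using x by (fastforce simp: free_group_def)
  then have "?y \<in> carrier (free_group A)"
    by (simp add: free_group_def reduced_foldr lists_foldr del: in_lists_conv_set)
  moreover have "?y \<otimes>\<^bsub>free_group A\<^esub> x = \<one>\<^bsub>free_group A\<^esub>"
    using foldr_rev_inv[of "[]" x] x
    by (simp add: free_group_def foldr_cons_letter_assoc foldr_cons_letter_Nil)
  ultimately show "\<exists>y\<in>carrier (free_group A). y \<otimes>\<^bsub>free_group A\<^esub> x = \<one>\<^bsub>free_group A\<^esub>"
    by blast
next
  fix x y assume "x \<in> carrier (free_group A)" "y \<in> carrier (free_group A)"
  then show "x \<otimes>\<^bsub>free_group A\<^esub> y \<in> carrier (free_group A)"
    by (simp add: free_group_def reduced_foldr lists_foldr del: in_lists_conv_set)
qed (auto simp: free_group_def foldr_cons_letter_assoc)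

text \<open>The generators form a basis.\<close>

lemma inv_free_group_generator:
  assumes "a \<in> A"
  shows "inv\<^bsub>free_group A\<^esub> [(a, s)] = [(a, \<not> s)]"
proof -
  interpret group "free_group A" by (rule group_free_group)
  show ?thesis
    by (rule inv_equality) (use assms in \<open>auto simp: free_group_def reduced_Cons\<close>)
qed

definition gen_letter :: "'a \<times> bool \<Rightarrow> ('a \<times> bool) list \<times> bool" where
  "gen_letter = (\<lambda>(a, s). ([(a, True)], s))"

lemma eval_word_generators:
  "w \<in> lists (A \<times> UNIV) \<Longrightarrow> eval_word (free_group A) (map gen_letter w) = foldr cons_letter w []"
proof (induction w)
  case Nil
  then show ?case by (simp add: eval_word_def free_group_def)
next
  case (Cons x w)
  obtain a s where x: "x = (a, s)" by (cases x)
  have "eval_letter (free_group A) (gen_letter x) = [x]"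
    using Cons.prems inv_free_group_generator[of a A True] by (auto simp: x gen_letter_def)
  moreover have "eval_word (free_group A) (map gen_letter w) = foldr cons_letter w []"
    using Cons by simp
  moreover have "[x] \<otimes>\<^bsub>free_group A\<^esub> v = cons_letter x v" for v
    by (simp add: free_group_def)
  ultimately show ?case by (simp add: eval_word_def)
qed

lemma inv_letter_gen_letter: "gen_letter y = inv_letter (gen_letter x) \<longleftrightarrow> y = inv_letter x"
  by (cases x; cases y) (auto simp: gen_letter_def)

lemma cons_letter_gen_letter: "cons_letter (gen_letter x) (map gen_letter w) = map gen_letter (cons_letter x w)"
  by (cases w) (auto simp: inv_letter_gen_letter)

lemma foldr_cons_letter_gen_letter:
  "foldr cons_letter (map gen_letter u) (map gen_letter v) = map gen_letter (foldr cons_letter u v)"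
  by (induction u) (auto simp: cons_letter_gen_letter)

lemma reduced_gen_letter: "reduced (map gen_letter w) \<longleftrightarrow> reduced w"
  by (induction w) (auto simp: reduced_Cons hd_map inv_letter_gen_letter)

lemma carrier_free_group_generators:
  "carrier (free_group ((\<lambda>a. [(a, True)]) ` A)) = map gen_letter ` carrier (free_group A)"
proof -
  have "(\<lambda>a. [(a, True)]) ` A \<times> UNIV = gen_letter ` (A \<times> UNIV)"
    by (force simp: gen_letter_def)
  then show ?thesis
    by (auto simp: free_group_def lists_image reduced_gen_letter simp del: in_lists_conv_set)
qed

lemma is_basis_generators: "is_basis (free_group A) ((\<lambda>a. [(a, True)]) ` A)"
proof -
  let ?F = "free_group A" and ?B = "(\<lambda>a. [(a, True)]) ` A"
  interpret group ?F by (rule group_free_group)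
  have eval: "eval_word ?F (map gen_letter w) = w" if "w \<in> carrier ?F" for w
    using that eval_word_generators[of w A]
    by (simp add: free_group_def foldr_cons_letter_Nil del: in_lists_conv_set)
  have mult: "map gen_letter u \<otimes>\<^bsub>free_group ?B\<^esub> map gen_letter v = map gen_letter (u \<otimes>\<^bsub>?F\<^esub> v)" for u v
    by (simp add: free_group_def foldr_cons_letter_gen_letter)
  have "eval_word ?F \<in> hom (free_group ?B) ?F"
    by (rule homI) (auto simp: carrier_free_group_generators eval mult)
  moreover have "bij_betw (eval_word ?F) (carrier (free_group ?B)) (carrier ?F)"
    unfolding carrier_free_group_generators
    by (rule bij_betw_byWitness[where f' = "map gen_letter"]) (auto simp: eval)
  moreover have "?B \<subseteq> carrier ?F"
    by (auto simp: free_group_def reduced_Cons)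
  ultimately show ?thesis by (simp add: is_basis_def iso_def)
qed

end

theory Submission
  imports Defs "HOL-Library.Sublist"
begin

text \<open>
  An inner automorphism changes all word lengths, hence all Gromov products, by a bounded amount only.
  Conversely, for every basis \<open>B\<close> the function \<open>exp (- (g|h))\<close> is a visual metric. Comparing each \<open>g\<close>
  with a neighbour further away from the root turns the Lipschitz condition into
  \<open>|g| \<le> |g\<phi>| + C\<close>, so that the inverse \<open>\<psi>\<close> of \<open>\<phi>\<close> does not increase translation lengths in any
  basis. The standard basis and the bases in which \<open>b\<close> is replaced by \<open>ba\<close> show that \<open>\<psi>\<close> maps each
  generator \<open>a\<close> to a conjugate of \<open>a\<close> or of its inverse; the products \<open>ab\<close> show that, given three
  generators, the conjugators can be chosen equal; and the bases in which \<open>a\<close> is replaced by \<open>abc\<close>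
  exclude the inverses.
\<close>

section \<open>Words and the free group\<close>

text \<open>The Lipschitz condition controls word lengths only up to an additive constant.
  Translation lengths remove it: evaluated on powers, the constant is negligible against the
  exponent, and conjugation changes nothing, which suits a statement about inner automorphisms. The
  passage to \<psi> comes from the direction of the estimate: for \<open>g = \<psi> h\<close> it
  reads |\<psi> h| \<le> |h| + C. A single basis cannot suffice, because permuting or inverting its
  generators preserves all lengths in it. Rank two is a genuine obstacle: inverting both generators
  is not inner there, yet it commutes with every automorphism up to inner ones, so in every basis it
  changes lengths by a bounded amount only. The third generator admits the substitution
  \<open>abc\<close>, which does distinguish \<open>a\<close> from its inverse. Lengths in another
  basis \<theta>(A) are computed in the standard one, with \<psi> replaced by its conjugate under
  \<theta>.\<close>

abbreviation inv_word :: "('a \<times> bool) list \<Rightarrow> ('a \<times> bool) list" where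
  "inv_word w \<equiv> map inv_letter (rev w)"

lemma inv_letter_eq_iff [simp]: "inv_letter x = inv_letter y \<longleftrightarrow> x = y"
  by (metis inv_letter_inv_letter)

lemma inv_letter_neq [simp]: "inv_letter x \<noteq> x" "x \<noteq> inv_letter x"
  by (cases x; simp)+

lemma fst_inv_letter [simp]: "fst (inv_letter x) = fst x"
  by (cases x) simp

lemma reduced_append:
  "reduced (u @ v) \<longleftrightarrow> reduced u \<and> reduced v \<and> (u = [] \<or> v = [] \<or> hd v \<noteq> inv_letter (last u))"
  by (auto simp: reduced_def successively_append_iff)

lemma reduced_inv_word: "reduced w \<Longrightarrow> reduced (inv_word w)"
proof (induction w)
  case (Cons x w)
  then show ?case
    by (cases w) (auto simp: reduced_append reduced_Cons)
qed simp

lemma length_cons_letter: "length (cons_letter x w) \<le> Suc (length w)"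
  by (cases w) auto

lemma length_foldr_cons_letter: "length (foldr cons_letter u v) \<le> length u + length v"
proof (induction u)
  case (Cons x u)
  then show ?case using length_cons_letter[of x "foldr cons_letter u v"] by simp
qed simp

lemma set_cons_letter: "set (cons_letter x w) \<subseteq> insert x (set w)"
  by (cases w) auto

lemma set_foldr_cons_letter: "set (foldr cons_letter u v) \<subseteq> set u \<union> set v"
proof (induction u)
  case (Cons x u)
  then show ?case using set_cons_letter[of x "foldr cons_letter u v"] by auto
qed simp

lemma fst_set_foldr_cons_letter:
  "fst ` set u \<subseteq> B \<Longrightarrow> fst ` set v \<subseteq> B \<Longrightarrow> fst ` set (foldr cons_letter u v) \<subseteq> B"
  by (metis Un_least image_Un image_mono set_foldr_cons_letter subset_trans)

lemma carrier_free_group_iff: "w \<in> carrier (free_group A) \<longleftrightarrow> fst ` set w \<subseteq> A \<and> reduced w"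
  by (force simp: free_group_def)

lemma one_free_group [simp]: "\<one>\<^bsub>free_group A\<^esub> = []"
  by (simp add: free_group_def)

lemma mult_free_group: "u \<otimes>\<^bsub>free_group A\<^esub> v = foldr cons_letter u v"
  by (simp add: free_group_def)

lemma mult_free_group_append:
  assumes "reduced (u @ v)"
  shows "u \<otimes>\<^bsub>free_group A\<^esub> v = u @ v"
  using foldr_cons_letter_Nil[OF assms] assms foldr_cons_letter_Nil[of v]
  by (simp add: mult_free_group reduced_append)

lemma length_mult_free_group: "length (u \<otimes>\<^bsub>free_group A\<^esub> v) \<le> length u + length v"
  by (simp add: mult_free_group length_foldr_cons_letter)

lemma inv_free_group:
  assumes "w \<in> carrier (free_group A)"
  shows "inv\<^bsub>free_group A\<^esub> w = inv_word w"
proof -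
  interpret F: group "free_group A" by (rule group_free_group)
  have "inv_word w \<in> carrier (free_group A)"
    using assms by (auto simp: carrier_free_group_iff reduced_inv_word image_subset_iff)
  moreover have "inv_word w \<otimes>\<^bsub>free_group A\<^esub> w = \<one>\<^bsub>free_group A\<^esub>"
    using foldr_rev_inv[of "[]" w] assms
    by (simp add: mult_free_group foldr_cons_letter_Nil carrier_free_group_iff)
  ultimately show ?thesis using assms F.inv_equality by blast
qed

lemma length_inv_free_group:
  "w \<in> carrier (free_group A) \<Longrightarrow> length (inv\<^bsub>free_group A\<^esub> w) = length w"
  by (simp add: inv_free_group)

section \<open>Cancellation and common prefixes\<close>

text \<open>What cancels in the product of the inverse of \<open>g\<close> with \<open>h\<close> is
  exactly the common prefix. The induction strips equal first letters; once the first letters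
  differ, \<open>inv_word g @ h\<close> is already reduced. This turns Gromov products at the
  identity into prefix lengths.\<close>

lemma length_inv_word_mult:
  assumes "reduced g" "reduced h"
  shows "length (foldr cons_letter (inv_word g) h) + 2 * length (longest_common_prefix g h)
    = length g + length h"
  using assms
proof (induction g h rule: longest_common_prefix.induct)
  case (1 x xs y ys)
  show ?case
  proof (cases "x = y")
    case True
    then show ?thesis using 1 by (auto simp: reduced_Cons)
  next
    case False
    have "reduced (inv_word (x # xs) @ y # ys)"
      unfolding reduced_append using 1(2,3) reduced_inv_word[of "x # xs"] False by (auto simp: last_map last_rev)
    from mult_free_group_append[OF this] False show ?thesis
      by (simp add: mult_free_group)
  qed
next
  case ("2_1" h)
  then show ?case by simp
next
  case ("2_2" g)
  then show ?case by (simp add: foldr_cons_letter_Nil reduced_inv_word del: foldr_append)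
qed

lemma length_inv_mult_free_group:
  assumes "g \<in> carrier (free_group A)" "h \<in> carrier (free_group A)"
  shows "length (inv\<^bsub>free_group A\<^esub> g \<otimes>\<^bsub>free_group A\<^esub> h) + 2 * length (longest_common_prefix g h)
    = length g + length h"
  using assms length_inv_word_mult[of g h]
  by (simp add: inv_free_group mult_free_group carrier_free_group_iff)

lemma longest_common_prefix_commute: "longest_common_prefix g h = longest_common_prefix h g"
  by (induction g h rule: longest_common_prefix.induct) auto

lemma longest_common_prefix_append_self: "longest_common_prefix g (g @ h) = g"
  by (induction g) auto

lemma length_longest_common_prefix_le: "length (longest_common_prefix g h) \<le> length g"
  using longest_common_prefix_prefix1 prefix_length_le by blast

text \<open>Both prefixes on the left are prefixes of \<open>k\<close>, hence comparable; the
  shorter one is then a common prefix of \<open>g\<close> and \<open>h\<close>.\<close>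

lemma longest_common_prefix_ultrametric:
  "min (length (longest_common_prefix g k)) (length (longest_common_prefix k h))
    \<le> length (longest_common_prefix g h)"
proof -
  have "prefix (longest_common_prefix g k) (longest_common_prefix k h)
      \<or> prefix (longest_common_prefix k h) (longest_common_prefix g k)"
    by (meson longest_common_prefix_prefix1 longest_common_prefix_prefix2 prefix_same_cases)
  then show ?thesis
    by (metis longest_common_prefix_max_prefix longest_common_prefix_prefix1
        longest_common_prefix_prefix2 min.coboundedI1 min.coboundedI2 prefix_length_le
        prefix_order.order_trans)
qed

lemma map_apfst_inv_letter: "apfst f (inv_letter x) = inv_letter (apfst f x)"
  by (cases x) simp

section \<open>Homomorphisms from free groups and bases\<close>

context group
begin

lemma inv_mult_cancel_left:
  "x \<in> carrier G \<Longrightarrow> y \<in> carrier G \<Longrightarrow> inv x \<otimes> (x \<otimes> y) = y"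
  by (simp flip: m_assoc)

lemma mult_inv_cancel_left:
  "x \<in> carrier G \<Longrightarrow> y \<in> carrier G \<Longrightarrow> x \<otimes> (inv x \<otimes> y) = y"
  by (simp flip: m_assoc)

lemmas cancel_simps = m_assoc inv_mult_group inv_mult_cancel_left mult_inv_cancel_left

lemma nat_pow_conj:
  assumes "u \<in> carrier G" "x \<in> carrier G"
  shows "(inv u \<otimes> x \<otimes> u) [^] (n::nat) = inv u \<otimes> x [^] n \<otimes> u"
  by (induction n) (use assms in \<open>simp_all add: cancel_simps\<close>)

lemma eval_letter_closed: "fst x \<in> carrier G \<Longrightarrow> eval_letter G x \<in> carrier G"
  by (cases x) simp

lemma eval_word_closed: "fst ` set w \<subseteq> carrier G \<Longrightarrow> eval_word G w \<in> carrier G"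
  by (induction w) (auto simp: eval_word_def eval_letter_closed)

lemma eval_word_Nil: "eval_word G [] = \<one>"
  by (simp add: eval_word_def)

lemma eval_word_Cons: "eval_word G (x # w) = eval_letter G x \<otimes> eval_word G w"
  by (simp add: eval_word_def)

lemma eval_letter_inv_letter:
  "fst x \<in> carrier G \<Longrightarrow> eval_letter G (inv_letter x) = inv (eval_letter G x)"
  by (cases x) simp

lemma fst_set_map_apfst: "fst ` set (map (apfst f) w) = f ` fst ` set w"
  by (simp add: image_comp o_def)

text \<open>A letter followed by its inverse evaluates to the identity, so free reduction does not
  change values.\<close>

lemma eval_word_map_cons_letter:
  assumes "f (fst x) \<in> carrier G" "f ` fst ` set w \<subseteq> carrier G"
  shows "eval_word G (map (apfst f) (cons_letter x w))
    = eval_letter G (apfst f x) \<otimes> eval_word G (map (apfst f) w)"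
proof (cases w)
  case Nil
  then show ?thesis by (simp add: eval_word_Cons)
next
  case (Cons y v)
  have "fst ` set (map (apfst f) v) \<subseteq> carrier G"
    using assms(2) Cons unfolding fst_set_map_apfst by simp
  from eval_word_closed[OF this] assms Cons show ?thesis
    by (simp add: eval_word_Cons map_apfst_inv_letter eval_letter_inv_letter mult_inv_cancel_left
        eval_letter_closed)
qed

lemma eval_word_map_foldr_cons_letter:
  assumes "f ` fst ` set u \<subseteq> carrier G" "f ` fst ` set v \<subseteq> carrier G"
  shows "eval_word G (map (apfst f) (foldr cons_letter u v))
    = eval_word G (map (apfst f) u) \<otimes> eval_word G (map (apfst f) v)"
  using assms(1)
proof (induction u)
  case Nil
  have "fst ` set (map (apfst f) v) \<subseteq> carrier G"
    using assms(2) unfolding fst_set_map_apfst .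
  from eval_word_closed[OF this] show ?case by (simp add: eval_word_Nil)
next
  case (Cons x u)
  have "fst ` set (foldr cons_letter u v) \<subseteq> {a. f a \<in> carrier G}"
    using Cons.prems assms(2) by (intro fst_set_foldr_cons_letter) (force simp: image_subset_iff)+
  then have 1: "f ` fst ` set (foldr cons_letter u v) \<subseteq> carrier G" by blast
  have "fst ` set (map (apfst f) u) \<subseteq> carrier G" "fst ` set (map (apfst f) v) \<subseteq> carrier G"
    using Cons.prems assms(2) unfolding fst_set_map_apfst by simp_all
  then show ?case
    using Cons eval_word_map_cons_letter[of f x "foldr cons_letter u v", OF _ 1]
    by (simp add: eval_word_Cons eval_letter_closed eval_word_closed m_assoc)
qed

text \<open>This is the universal property of the free group. Renaming by \<open>f\<close> comes
  first because \<open>eval_word\<close> only reads letters that are already group elements.\<close>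

lemma eval_word_map_hom:
  assumes "f ` A \<subseteq> carrier G"
  shows "(\<lambda>w. eval_word G (map (apfst f) w)) \<in> hom (free_group A) G"
proof (rule homI)
  fix u v assume "u \<in> carrier (free_group A)" "v \<in> carrier (free_group A)"
  then have u: "f ` fst ` set u \<subseteq> carrier G" and v: "f ` fst ` set v \<subseteq> carrier G"
    using assms unfolding carrier_free_group_iff by (blast dest: subsetD)+
  show "eval_word G (map (apfst f) u) \<in> carrier G"
    using u by (intro eval_word_closed) (simp only: fst_set_map_apfst)
  show "eval_word G (map (apfst f) (u \<otimes>\<^bsub>free_group A\<^esub> v))
      = eval_word G (map (apfst f) u) \<otimes> eval_word G (map (apfst f) v)"
    using eval_word_map_foldr_cons_letter[OF u v] by (simp add: mult_free_group)
qed

lemma eval_word_hom: "B \<subseteq> carrier G \<Longrightarrow> eval_word G \<in> hom (free_group B) G"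
  using eval_word_map_hom[of id B] by simp

end

lemma hom_eval_letter:
  assumes "group G" "group H" "h \<in> hom G H" "fst x \<in> carrier G"
  shows "h (eval_letter G x) = eval_letter H (apfst h x)"
proof -
  interpret group_hom G H h using assms by (simp add: group_hom_def group_hom_axioms_def)
  show ?thesis using assms(4) by (cases x) simp
qed

lemma hom_eval_word:
  assumes "group G" "group H" "h \<in> hom G H" "fst ` set w \<subseteq> carrier G"
  shows "h (eval_word G w) = eval_word H (map (apfst h) w)"
proof -
  interpret group_hom G H h using assms by (simp add: group_hom_def group_hom_axioms_def)
  show ?thesis
    using assms(4)
    by (induction w) (auto simp: eval_word_def hom_eval_letter[OF assms(1-3)]
        G.eval_letter_closed G.eval_word_closed[unfolded eval_word_def] simp del: apfst_conv)
qed

lemma eval_word_free_group: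
  assumes "w \<in> carrier (free_group A)"
  shows "eval_word (free_group A) (map (apfst (\<lambda>a. [(a, True)])) w) = w"
proof -
  have "apfst (\<lambda>a::'a. [(a, True)]) = gen_letter"
    by (auto simp: gen_letter_def)
  moreover have "w \<in> lists (A \<times> UNIV)" "reduced w"
    using assms by (auto simp: free_group_def)
  ultimately show ?thesis
    using eval_word_generators[of w A] foldr_cons_letter_Nil[of w] by simp
qed

lemma generator_closed: "a \<in> A \<Longrightarrow> [(a, s)] \<in> carrier (free_group A)"
  by (simp add: carrier_free_group_iff reduced_Cons)

section \<open>Determination by generators and renaming of letters\<close>

lemma hom_free_group_eq_eval_word:
  assumes "group G" "h \<in> hom (free_group A) G" "w \<in> carrier (free_group A)"
  shows "h w = eval_word G (map (apfst (\<lambda>a. h [(a, True)])) w)"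
proof -
  have "h w = h (eval_word (free_group A) (map (apfst (\<lambda>a. [(a, True)])) w))"
    by (simp add: eval_word_free_group[OF assms(3)])
  also have "\<dots> = eval_word G (map (apfst h) (map (apfst (\<lambda>a. [(a, True)])) w))"
    using assms by (intro hom_eval_word[OF group_free_group])
      (auto simp: carrier_free_group_iff reduced_Cons)
  finally show ?thesis by (simp add: o_def apfst_def map_prod_def case_prod_unfold)
qed

text \<open>Agreement is asked only on the generators occurring in \<open>w\<close>;
  \<open>subst_gen_fixed\<close> relies on this form.\<close>

lemma hom_free_group_eqI:
  assumes "group G" "h \<in> hom (free_group A) G" "k \<in> hom (free_group A) G"
    "w \<in> carrier (free_group A)" "\<And>a. a \<in> fst ` set w \<Longrightarrow> h [(a, True)] = k [(a, True)]"
  shows "h w = k w"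
proof -
  have "map (apfst (\<lambda>a. h [(a, True)])) w = map (apfst (\<lambda>a. k [(a, True)])) w"
    using assms(5)[OF imageI] by (fastforce simp: apfst_def map_prod_def split: prod.splits)
  then show ?thesis
    using hom_free_group_eq_eval_word[OF assms(1,2,4)] hom_free_group_eq_eval_word[OF assms(1,3,4)]
    by (simp only:)
qed

text \<open>Words over a basis have group elements as letters, words over \<open>A\<close> have
  elements of \<open>A\<close>; renaming connects the two. Injectivity prevents new
  cancellations.\<close>

lemma map_apfst_closed:
  assumes "inj_on f A" "w \<in> carrier (free_group A)"
  shows "map (apfst f) w \<in> carrier (free_group (f ` A))"
proof -
  have "reduced (map (apfst f) w)" if "fst ` set w \<subseteq> A" "reduced w" for w
    using that
  proof (induction w)
    case (Cons x w)
    then show ?case using assms(1)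
      by (cases w; cases x) (auto simp: reduced_Cons inj_on_def)
  qed simp
  with assms(2) show ?thesis by (auto simp: carrier_free_group_iff)
qed

lemma map_apfst_hom:
  assumes "inj_on f A"
  shows "map (apfst f) \<in> hom (free_group A) (free_group (f ` A))"
proof (rule homI)
  have cons: "map (apfst f) (cons_letter x w) = cons_letter (apfst f x) (map (apfst f) w)"
    if "fst x \<in> A" "fst ` set w \<subseteq> A" for x w
    using that assms by (cases x; cases w) (auto simp: inj_on_def)
  have foldr: "map (apfst f) (foldr cons_letter u v)
      = foldr cons_letter (map (apfst f) u) (map (apfst f) v)"
    if "fst ` set u \<subseteq> A" "fst ` set v \<subseteq> A" for u v
    using that(1)
  proof (induction u)
    case (Cons x u)
    have "fst ` set (foldr cons_letter u v) \<subseteq> A"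
      using Cons.prems that(2) by (intro fst_set_foldr_cons_letter) auto
    with Cons show ?case by (simp add: cons)
  qed simp
  show "map (apfst f) (u \<otimes>\<^bsub>free_group A\<^esub> v)
      = map (apfst f) u \<otimes>\<^bsub>free_group (f ` A)\<^esub> map (apfst f) v"
    if "u \<in> carrier (free_group A)" "v \<in> carrier (free_group A)" for u v
    using that by (simp add: mult_free_group foldr carrier_free_group_iff)
qed (simp add: map_apfst_closed assms)

lemma map_apfst_iso:
  assumes "inj_on f A"
  shows "map (apfst f) \<in> iso (free_group A) (free_group (f ` A))"
proof -
  let ?g = "inv_into A f"
  have inj: "inj_on ?g (f ` A)" by (rule inj_on_inv_into) simp
  have img: "?g ` f ` A = A" using assms by (simp add: image_comp o_def)
  have "bij_betw (map (apfst f)) (carrier (free_group A)) (carrier (free_group (f ` A)))"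
  proof (rule bij_betw_byWitness[where f' = "map (apfst ?g)"])
    show "\<forall>w\<in>carrier (free_group A). map (apfst ?g) (map (apfst f) w) = w"
      using assms by (force simp: carrier_free_group_iff intro!: map_idI)
    show "\<forall>w\<in>carrier (free_group (f ` A)). map (apfst f) (map (apfst ?g) w) = w"
      by (force simp: carrier_free_group_iff f_inv_into_f intro!: map_idI)
    show "map (apfst f) ` carrier (free_group A) \<subseteq> carrier (free_group (f ` A))"
      using map_apfst_closed[OF assms] by blast
    show "map (apfst ?g) ` carrier (free_group (f ` A)) \<subseteq> carrier (free_group A)"
      using map_apfst_closed[OF inj] img by auto
  qed
  with map_apfst_hom[OF assms] show ?thesis by (simp add: iso_def)
qed

section \<open>Coordinates in a basis and the word metric\<close>

definition word_in_basis :: "('g, 'm) monoid_scheme \<Rightarrow> 'g set \<Rightarrow> 'g \<Rightarrow> ('g \<times> bool) list" where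
  "word_in_basis G B = inv_into (carrier (free_group B)) (eval_word G)"

lemma word_in_basis_iso: "is_basis G B \<Longrightarrow> word_in_basis G B \<in> iso G (free_group B)"
  unfolding word_in_basis_def is_basis_def
  by (intro group.iso_set_sym[OF group_free_group]) simp

lemma word_in_basis_eval_word:
  "is_basis G B \<Longrightarrow> w \<in> carrier (free_group B) \<Longrightarrow> word_in_basis G B (eval_word G w) = w"
  unfolding word_in_basis_def is_basis_def
  by (auto simp: iso_def bij_betw_def)

lemma eval_word_in_basis:
  "is_basis G B \<Longrightarrow> g \<in> carrier G \<Longrightarrow> eval_word G (word_in_basis G B g) = g"
  unfolding word_in_basis_def is_basis_def
  by (auto simp: iso_def bij_betw_def f_inv_into_f)

text \<open>Renaming letters and then evaluating is \<theta> itself; as renaming and \<theta> are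
  bijective, so is evaluation. The second claim makes the length of \<open>\<theta> w\<close> in the
  new basis equal to the length of \<open>w\<close>.\<close>

lemma iso_imp_is_basis:
  assumes "group G" "\<theta> \<in> iso (free_group A) G"
  shows "is_basis G ((\<lambda>a. \<theta> [(a, True)]) ` A)"
    and "w \<in> carrier (free_group A) \<Longrightarrow>
      word_in_basis G ((\<lambda>a. \<theta> [(a, True)]) ` A) (\<theta> w) = map (apfst (\<lambda>a. \<theta> [(a, True)])) w"
proof -
  let ?f = "\<lambda>a. \<theta> [(a, True)]"
  have \<theta>: "\<theta> \<in> hom (free_group A) G" "bij_betw \<theta> (carrier (free_group A)) (carrier G)"
    using assms(2) by (auto simp: iso_def)
  have eval: "eval_word G (map (apfst ?f) w) = \<theta> w" if "w \<in> carrier (free_group A)" for w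
    using hom_free_group_eq_eval_word[OF assms(1) \<theta>(1) that] by simp
  have inj: "inj_on ?f A"
    using \<theta>(2) generator_closed[of _ A True] by (fastforce simp: inj_on_def bij_betw_def)
  have sub: "?f ` A \<subseteq> carrier G"
    using \<theta>(1) generator_closed[of _ A True] by (auto simp: hom_def)
  have "bij_betw (map (apfst ?f)) (carrier (free_group A)) (carrier (free_group (?f ` A)))"
    using map_apfst_iso[OF inj] by (simp add: iso_def)
  moreover have "bij_betw (eval_word G \<circ> map (apfst ?f)) (carrier (free_group A)) (carrier G)"
    using \<theta>(2) eval by (simp cong: bij_betw_cong)
  ultimately have "bij_betw (eval_word G) (carrier (free_group (?f ` A))) (carrier G)"
    by (simp add: bij_betw_comp_iff)
  with group.eval_word_hom[OF assms(1) sub] sub show basis: "is_basis G (?f ` A)"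
    by (simp add: is_basis_def iso_def)
  show "word_in_basis G (?f ` A) (\<theta> w) = map (apfst ?f) w" if "w \<in> carrier (free_group A)"
    using word_in_basis_eval_word[OF basis map_apfst_closed[OF inj that]] eval[OF that] by simp
qed

text \<open>\<open>word_dist\<close> minimises over all words. Reducing a word preserves its value
  and never lengthens it, and the reduced word with a given value is unique, so that word attains
  the minimum.\<close>

lemma word_dist_basis:
  fixes G (structure)
  assumes "group G" "is_basis G B" "g \<in> carrier G" "h \<in> carrier G"
  shows "word_dist G B g h = length (word_in_basis G B (inv g \<otimes> h))"
proof -
  interpret group G by fact
  have B: "B \<subseteq> carrier G" using assms(2) by (simp add: is_basis_def)
  let ?x = "inv g \<otimes> h"
  let ?w = "word_in_basis G B ?x"
  have w: "?w \<in> carrier (free_group B)"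
    using word_in_basis_iso[OF assms(2)] assms(3,4)
    by (intro hom_in_carrier[of "word_in_basis G B" G]) (auto simp: iso_def)
  have eval: "g \<otimes> eval_word G v = h \<longleftrightarrow> eval_word G v = ?x" if "fst ` set v \<subseteq> B" for v
    using that B assms(3,4) eval_word_closed[of v] by (auto simp: inv_solve_left)
  show ?thesis
    unfolding word_dist_def
  proof (rule Least_equality)
    show "\<exists>v\<in>lists (B \<times> UNIV). length v = length ?w \<and> g \<otimes> eval_word G v = h"
      using w eval eval_word_in_basis[OF assms(2), of ?x] assms(3,4)
      by (intro bexI[of _ ?w]) (auto simp: carrier_free_group_iff image_subset_iff mult_inv_cancel_left)
  next
    fix n assume "\<exists>v\<in>lists (B \<times> UNIV). length v = n \<and> g \<otimes> eval_word G v = h"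
    then obtain v where v: "v \<in> lists (B \<times> UNIV)" "length v = n" "g \<otimes> eval_word G v = h"
      by blast
    then have fv: "fst ` set v \<subseteq> B" by auto
    have r: "foldr cons_letter v [] \<in> carrier (free_group B)"
      using v(1) lists_foldr[of v B "[]"] by (simp add: free_group_def reduced_foldr del: in_lists_conv_set)
    have "eval_word G (foldr cons_letter v []) = eval_word G v"
      using eval_word_map_foldr_cons_letter[of id v "[]"] fv B eval_word_closed[of v]
      by (auto simp: eval_word_Nil)
    then have "?w = foldr cons_letter v []"
      using word_in_basis_eval_word[OF assms(2) r] eval[OF fv] v(3) by simp
    then show "length ?w \<le> n"
      using length_foldr_cons_letter[of v "[]"] v(2) by simp
  qed
qed

lemma length_word_in_basis_mult:
  fixes G (structure)
  assumes "is_basis G B" "g \<in> carrier G" "h \<in> carrier G"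
  shows "length (word_in_basis G B (g \<otimes> h))
    \<le> length (word_in_basis G B g) + length (word_in_basis G B h)"
proof -
  have "word_in_basis G B \<in> hom G (free_group B)"
    using word_in_basis_iso[OF assms(1)] by (simp add: iso_def)
  with assms(2,3) show ?thesis by (simp add: hom_mult length_mult_free_group)
qed

lemma length_word_in_basis_inv:
  fixes G (structure)
  assumes "group G" "is_basis G B" "g \<in> carrier G"
  shows "length (word_in_basis G B (inv g)) = length (word_in_basis G B g)"
proof -
  interpret group_hom G "free_group B" "word_in_basis G B"
    using assms word_in_basis_iso[OF assms(2)] group_free_group
    by (auto simp: iso_def group_hom_def group_hom_axioms_def)
  show ?thesis using assms(3) by (simp add: length_inv_free_group)
qed

section \<open>Lipschitz conditions and word lengths\<close>

lemma inner_imp_lipschitz_condition: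
  fixes G (structure)
  assumes "group G" "is_basis G B" "a \<in> carrier G" "p \<in> carrier G" "\<gamma> > 0" "T \<ge> 1"
    and d: "d \<in> visual_metrics G B p \<gamma> T"
  shows "lipschitz_condition (carrier G) d (\<lambda>g\<in>carrier G. inv a \<otimes> g \<otimes> a)"
proof -
  interpret group G by fact
  interpret Metric_space "carrier G" d
    using d unfolding visual_metrics_def by blast
  let ?l = "\<lambda>g. length (word_in_basis G B g)"
  let ?f = "\<lambda>g. inv a \<otimes> g \<otimes> a"
  \<comment> \<open>Two uses of the bound \<open>p\<close> and one of \<open>q\<close>, halved as in
    the Gromov product, cost the first summand plus \<open>2 * ?l a\<close>; this \<open>M\<close>
    leaves some room.\<close>
  define M where "M = ?l (inv p \<otimes> a \<otimes> p) + 3 * ?l a"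
  have dist: "word_dist G B g h = ?l (inv g \<otimes> h)" if "g \<in> carrier G" "h \<in> carrier G" for g h
    using word_dist_basis[OF assms(1,2) that] .
  note l_mult = length_word_in_basis_mult[OF assms(2)]
  note l_inv = length_word_in_basis_inv[OF assms(1,2)]
  have p: "?l (inv p \<otimes> g) \<le> ?l (inv p \<otimes> ?f g) + ?l (inv p \<otimes> a \<otimes> p) + ?l a"
    if g: "g \<in> carrier G" for g
  proof -
    have eq: "inv p \<otimes> g = (inv p \<otimes> a \<otimes> p) \<otimes> ((inv p \<otimes> ?f g) \<otimes> inv a)"
      using g assms(3,4) by (simp add: cancel_simps)
    have "?l ((inv p \<otimes> a \<otimes> p) \<otimes> ((inv p \<otimes> ?f g) \<otimes> inv a)) \<le> ?l (inv p \<otimes> a \<otimes> p) + (?l (inv p \<otimes> ?f g) + ?l (inv a))"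
      using l_mult[of "inv p \<otimes> a \<otimes> p" "(inv p \<otimes> ?f g) \<otimes> inv a"]
        l_mult[of "inv p \<otimes> ?f g" "inv a"] g assms(3,4) by simp
    then show ?thesis using l_inv[OF assms(3)] unfolding eq by linarith
  qed
  have q: "?l (inv (?f g) \<otimes> ?f h) \<le> ?l (inv g \<otimes> h) + 2 * ?l a"
    if gh: "g \<in> carrier G" "h \<in> carrier G" for g h
  proof -
    have eq: "inv (?f g) \<otimes> ?f h = inv a \<otimes> ((inv g \<otimes> h) \<otimes> a)"
      using gh assms(3) by (simp add: cancel_simps)
    have "?l (inv a \<otimes> ((inv g \<otimes> h) \<otimes> a)) \<le> ?l (inv a) + (?l (inv g \<otimes> h) + ?l a)"
      using l_mult[of "inv a" "(inv g \<otimes> h) \<otimes> a"] l_mult[of "inv g \<otimes> h" a] gh assms(3) by simp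
    then show ?thesis using l_inv[OF assms(3)] unfolding eq by linarith
  qed
  have gp: "gromov_product G B p g h \<le> gromov_product G B p (?f g) (?f h) + real M"
    if gh: "g \<in> carrier G" "h \<in> carrier G" for g h
  proof -
    have fgh: "?f g \<in> carrier G" "?f h \<in> carrier G" using gh assms(3) by auto
    show ?thesis
      unfolding gromov_product_def dist[OF assms(4) gh(1)] dist[OF assms(4) gh(2)] dist[OF gh]
        dist[OF assms(4) fgh(1)] dist[OF assms(4) fgh(2)] dist[OF fgh] M_def
      using p[OF gh(1), THEN of_nat_mono[where 'a = real]] q[OF gh, THEN of_nat_mono[where 'a = real]]
        p[OF gh(2), THEN of_nat_mono[where 'a = real]]
      by (simp add: field_simps)
  qed
  \<comment> \<open>One factor \<open>T\<close> comes from the upper bound on \<open>d\<close> at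
    the images, the other from the lower bound at \<open>g\<close> and \<open>h\<close>.\<close>
  let ?K = "T * (T * exp (\<gamma> * real M))"
  have "d (?f g) (?f h) \<le> ?K * d g h" if gh: "g \<in> carrier G" "h \<in> carrier G" for g h
  proof (cases "g = h")
    case True
    then show ?thesis using gh assms(3) by simp
  next
    case False
    have fgh: "?f g \<in> carrier G" "?f h \<in> carrier G" "?f g \<noteq> ?f h"
      using gh assms(3) False by auto
    have "d (?f g) (?f h) \<le> T * visual_rho G B p \<gamma> (?f g) (?f h)"
      using d fgh by (auto simp: visual_metrics_def)
    also have "\<dots> = T * exp (- (\<gamma> * gromov_product G B p (?f g) (?f h)))"
      using fgh by (simp add: visual_rho_def)
    also have "\<dots> \<le> T * exp (\<gamma> * real M + - (\<gamma> * gromov_product G B p g h))"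
      using mult_left_mono[OF gp[OF gh], of \<gamma>] assms(5,6) by (simp add: algebra_simps)
    also have "\<dots> = T * exp (\<gamma> * real M) * visual_rho G B p \<gamma> g h"
      using False by (simp add: exp_add[symmetric] visual_rho_def)
    also have "\<dots> \<le> T * exp (\<gamma> * real M) * (T * d g h)"
    proof -
      have "1 / T * visual_rho G B p \<gamma> g h \<le> d g h"
        using d gh False by (auto simp: visual_metrics_def)
      then have "visual_rho G B p \<gamma> g h \<le> T * d g h"
        using assms(6) by (simp add: field_simps)
      then show ?thesis using assms(6) by (intro mult_left_mono) auto
    qed
    finally show ?thesis by (simp add: mult_ac)
  qed
  moreover have "?K > 0" using assms(6) by simp
  ultimately show ?thesis unfolding lipschitz_condition_def by (auto intro!: exI[of _ ?K])
qed

section \<open>The Lipschitz condition as a bound on word lengths\<close>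

text \<open>In a tree, the Gromov product at the root is the length of the common prefix; hence
  \<open>exp (- (g|h))\<close> is itself an ultrametric.\<close>

definition prefix_dist :: "('g, 'm) monoid_scheme \<Rightarrow> 'g set \<Rightarrow> 'g \<Rightarrow> 'g \<Rightarrow> real" where
  "prefix_dist G B g h = (if g = h then 0
    else exp (- real (length (longest_common_prefix (word_in_basis G B g) (word_in_basis G B h)))))"

lemma prefix_dist_visual:
  fixes G (structure)
  assumes "group G" "is_basis G B"
  shows "prefix_dist G B \<in> visual_metrics G B \<one> 1 1"
proof -
  interpret group G by fact
  let ?k = "word_in_basis G B"
  have hom: "?k \<in> hom G (free_group B)"
    using word_in_basis_iso[OF assms(2)] by (simp add: iso_def)
  interpret k: group_hom G "free_group B" ?k
    using hom group_free_group assms by (auto simp: group_hom_def group_hom_axioms_def)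
  have gromov: "gromov_product G B \<one> g h = real (length (longest_common_prefix (?k g) (?k h)))"
    if gh: "g \<in> carrier G" "h \<in> carrier G" for g h
  proof -
    have 1: "word_dist G B \<one> g = length (?k g)" "word_dist G B \<one> h = length (?k h)"
      using gh word_dist_basis[OF assms one_closed] by auto
    have "word_dist G B g h
        + 2 * length (longest_common_prefix (?k g) (?k h)) = length (?k g) + length (?k h)"
      using word_dist_basis[OF assms gh] gh length_inv_mult_free_group[of "?k g" B "?k h"]
      by simp
    from arg_cong[OF this, of real] 1 show ?thesis by (simp add: gromov_product_def)
  qed
  have "Metric_space (carrier G) (prefix_dist G B)"
  proof
    fix x y z assume "x \<in> carrier G" "y \<in> carrier G" "z \<in> carrier G"
    let ?p = "\<lambda>x y. length (longest_common_prefix (?k x) (?k y))"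
    show "prefix_dist G B x z \<le> prefix_dist G B x y + prefix_dist G B y z"
    \<comment> \<open>On the diagonal the value 0 does not come from the exponential, so coinciding
      points are treated apart.\<close>
    proof (cases "x = y \<or> y = z \<or> x = z")
      case True
      then show ?thesis by (auto simp: prefix_dist_def)
    next
      case False
      have "exp (- real (?p x z)) \<le> exp (- real (?p x y)) + exp (- real (?p y z))"
      proof (cases "?p x y \<le> ?p y z")
        case True
        then have "exp (- real (?p x z)) \<le> exp (- real (?p x y))"
          using longest_common_prefix_ultrametric[of "?k x" "?k y" "?k z"] by simp
        then show ?thesis by (simp add: add_increasing2)
      next
        case False
        then have "exp (- real (?p x z)) \<le> exp (- real (?p y z))"
          using longest_common_prefix_ultrametric[of "?k x" "?k y" "?k z"] by simp
        then show ?thesis by (simp add: add_increasing)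
      qed
      with False show ?thesis by (simp add: prefix_dist_def)
    qed
  qed (auto simp: prefix_dist_def longest_common_prefix_commute)
  then show ?thesis
    by (simp add: visual_metrics_def visual_rho_def gromov prefix_dist_def)
qed

text \<open>A one-letter extension \<open>h\<close> of \<open>g\<close> lies at distance exactly exp
  (- |g|) from it, whereas every point other than \<open>\<phi> g\<close> lies at distance at least
  exp (- |\<phi> g|) from \<open>\<phi> g\<close>. Injectivity makes the second bound applicable to
  \<open>\<phi> h\<close>, and taking logarithms leaves the additive constant
  \<open>ln K\<close>.\<close>

lemma lipschitz_condition_imp_length_le:
  fixes G (structure)
  assumes "group G" "is_basis G B" "B \<noteq> {}"
    and \<phi>: "\<phi> ` carrier G \<subseteq> carrier G" "inj_on \<phi> (carrier G)"
    and lip: "lipschitz_condition (carrier G) (prefix_dist G B) \<phi>"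
  shows "\<exists>C. \<forall>g\<in>carrier G.
    length (word_in_basis G B g) \<le> length (word_in_basis G B (\<phi> g)) + C"
proof -
  interpret group G by fact
  let ?k = "word_in_basis G B"
  have bij: "bij_betw ?k (carrier G) (carrier (free_group B))"
    using word_in_basis_iso[OF assms(2)] by (simp add: iso_def)
  obtain K where K: "K > 0"
    "\<And>g h. g \<in> carrier G \<Longrightarrow> h \<in> carrier G \<Longrightarrow>
      prefix_dist G B (\<phi> g) (\<phi> h) \<le> K * prefix_dist G B g h"
    using lip by (auto simp: lipschitz_condition_def)
  have "length (?k g) \<le> length (?k (\<phi> g)) + nat \<lceil>ln K\<rceil>" if g: "g \<in> carrier G" for g
  proof -
    obtain b where b: "b \<in> B" using assms(3) by blast
    \<comment> \<open>Repeating the last letter never cancels; after the empty word any letter will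
      do.\<close>
    define s where "s = (if ?k g = [] then (b, True) else last (?k g))"
    have kg: "?k g \<in> carrier (free_group B)" using bij g by (auto simp: bij_betw_def)
    have "last (?k g) \<in> set (?k g)" if "?k g \<noteq> []" using that by simp
    then have "?k g @ [s] \<in> carrier (free_group B)"
      using kg b by (auto simp: carrier_free_group_iff s_def reduced_append reduced_Cons)
    then obtain h where h: "h \<in> carrier G" "?k h = ?k g @ [s]"
      using bij by (metis bij_betw_imp_surj_on imageE)
    have "g \<noteq> h" using h(2) by auto
    then have "\<phi> g \<noteq> \<phi> h" using \<phi>(2) g h(1) by (auto simp: inj_on_def)
    have "exp (- real (length (?k (\<phi> g)))) \<le> prefix_dist G B (\<phi> g) (\<phi> h)"
      using \<open>\<phi> g \<noteq> \<phi> h\<close> by (simp add: prefix_dist_def length_longest_common_prefix_le)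
    also have "\<dots> \<le> K * exp (- real (length (?k g)))"
      using K(2)[OF g h(1)] \<open>g \<noteq> h\<close>
      by (simp add: prefix_dist_def h(2) longest_common_prefix_append_self)
    also have "\<dots> = exp (ln K - real (length (?k g)))"
      using K(1) by (simp add: exp_diff exp_minus field_simps)
    finally have "real (length (?k g)) \<le> real (length (?k (\<phi> g))) + ln K" by simp
    then show ?thesis by linarith
  qed
  then show ?thesis by blast
qed

section \<open>Stable lengths\<close>

text \<open>\<open>stable_length_le A L x\<close> says that the translation length of \<open>x\<close> on the Cayley tree is at
  most \<open>L\<close>. For a cyclically reduced word, i.e. \<open>c\<close> with \<open>c @ c\<close> reduced, that length is \<open>length c\<close>.\<close>

definition stable_length_le :: "'a set \<Rightarrow> nat \<Rightarrow> ('a \<times> bool) list \<Rightarrow> bool" where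
  "stable_length_le A L x \<longleftrightarrow> (\<exists>C. \<forall>n::nat. length (x [^]\<^bsub>free_group A\<^esub> n) \<le> L * n + C)"

lemma length_nat_pow_free_group: "length (x [^]\<^bsub>free_group A\<^esub> (n::nat)) \<le> length x * n"
proof (induction n)
  case (Suc n)
  then show ?case
    using length_mult_free_group[where A = A and u = "x [^]\<^bsub>free_group A\<^esub> n" and v = x] by simp
qed simp

lemma reduced_concat_replicate:
  assumes "reduced (c @ c)"
  shows "reduced (concat (replicate n c) @ c)"
proof (cases "c = []")
  case False
  \<comment> \<open>The claim on the head is carried along so that each new junction is the one
    inside \<open>c @ c\<close>.\<close>
  have "reduced (concat (replicate n c) @ c) \<and> hd (concat (replicate n c) @ c) = hd c"
  proof (induction n)
    case (Suc n)
    then show ?case using assms False by (auto simp: reduced_append)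
  qed (use assms in \<open>simp add: reduced_append\<close>)
  then show ?thesis by simp
qed simp

lemma nat_pow_free_group:
  "reduced (c @ c) \<Longrightarrow> c [^]\<^bsub>free_group A\<^esub> (n::nat) = concat (replicate n c)"
proof (induction n)
  case (Suc n)
  have "concat (replicate n c) @ c = concat (replicate (Suc n) c)"
    by (induction n) auto
  with Suc reduced_concat_replicate[of c n] show ?case
    by (simp add: mult_free_group_append)
qed simp

text \<open>Powers of \<open>c\<close> do not cancel, so their lengths grow with slope
  \<open>length c\<close>. The exponent \<open>Suc C\<close> already contradicts a larger slope,
  since (L + 1)(C + 1) exceeds L(C + 1) + C.\<close>

lemma stable_length_le_cyclically_reduced:
  assumes "reduced (c @ c)" "stable_length_le A L c"
  shows "length c \<le> L"
proof (rule ccontr)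
  assume "\<not> length c \<le> L"
  obtain C where C: "\<And>n::nat. length (c [^]\<^bsub>free_group A\<^esub> n) \<le> L * n + C"
    using assms(2) by (auto simp: stable_length_le_def)
  have "length (concat (replicate n c)) = n * length c" for n
    by (induction n) auto
  then have "Suc C * length c \<le> L * Suc C + C"
    using C[of "Suc C"] nat_pow_free_group[OF assms(1), of A "Suc C"] by simp
  moreover have "Suc C * Suc L \<le> Suc C * length c"
    using \<open>\<not> length c \<le> L\<close> by (intro mult_le_mono) auto
  ultimately show False by (simp add: algebra_simps)
qed

text \<open>Each power of a conjugate is the conjugate of the power, so its length changes by at
  most twice that of the conjugator, whatever the exponent. The converse conjugates back.\<close>

lemma stable_length_le_conj:
  fixes A defines "F \<equiv> free_group A"
  assumes "u \<in> carrier F" "x \<in> carrier F"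
  shows "stable_length_le A L (inv\<^bsub>F\<^esub> u \<otimes>\<^bsub>F\<^esub> x \<otimes>\<^bsub>F\<^esub> u) \<longleftrightarrow> stable_length_le A L x"
proof -
  interpret group F unfolding F_def by (rule group_free_group)
  have conj: "stable_length_le A L (inv\<^bsub>F\<^esub> v \<otimes>\<^bsub>F\<^esub> y \<otimes>\<^bsub>F\<^esub> v)"
    if v: "v \<in> carrier F" and y: "y \<in> carrier F" and le: "stable_length_le A L y" for v y
  proof -
    obtain C where C: "\<And>n::nat. length (y [^]\<^bsub>F\<^esub> n) \<le> L * n + C"
      using le by (auto simp: stable_length_le_def F_def)
    have "length ((inv\<^bsub>F\<^esub> v \<otimes>\<^bsub>F\<^esub> y \<otimes>\<^bsub>F\<^esub> v) [^]\<^bsub>F\<^esub> n) \<le> L * n + (C + 2 * length v)"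
      for n :: nat
    proof -
      have "length (inv\<^bsub>F\<^esub> v \<otimes>\<^bsub>F\<^esub> y [^]\<^bsub>F\<^esub> n \<otimes>\<^bsub>F\<^esub> v) \<le> length v + length (y [^]\<^bsub>F\<^esub> n) + length v"
        using length_mult_free_group[of A "inv\<^bsub>F\<^esub> v \<otimes>\<^bsub>F\<^esub> y [^]\<^bsub>F\<^esub> n" v]
          length_mult_free_group[of A "inv\<^bsub>F\<^esub> v" "y [^]\<^bsub>F\<^esub> n"] length_inv_free_group[of v A] v
        unfolding F_def by linarith
      with C[of n] show ?thesis
        unfolding nat_pow_conj[OF v y] by linarith
    qed
    then show ?thesis unfolding stable_length_le_def F_def by blast
  qed
  have "inv\<^bsub>F\<^esub> (inv\<^bsub>F\<^esub> u) \<otimes>\<^bsub>F\<^esub> (inv\<^bsub>F\<^esub> u \<otimes>\<^bsub>F\<^esub> x \<otimes>\<^bsub>F\<^esub> u) \<otimes>\<^bsub>F\<^esub> inv\<^bsub>F\<^esub> u = x"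
    using assms(2,3) by (simp add: cancel_simps)
  then show ?thesis
    using conj[OF assms(2,3)] conj[of "inv\<^bsub>F\<^esub> u" "inv\<^bsub>F\<^esub> u \<otimes>\<^bsub>F\<^esub> x \<otimes>\<^bsub>F\<^esub> u"] assms(2,3) by auto
qed

text \<open>If \<open>w @ w\<close> is not reduced, the first letter of \<open>w\<close> is inverse
  to its last; stripping both gives a shorter word conjugate to \<open>w\<close>.\<close>

lemma conj_cyclically_reduced:
  fixes A defines "F \<equiv> free_group A"
  assumes "w \<in> carrier F"
  shows "\<exists>u\<in>carrier F. \<exists>c\<in>carrier F. reduced (c @ c) \<and> w = inv\<^bsub>F\<^esub> u \<otimes>\<^bsub>F\<^esub> c \<otimes>\<^bsub>F\<^esub> u"
  using assms(2)
proof (induction "length w" arbitrary: w rule: less_induct)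
  case less
  interpret group F unfolding F_def by (rule group_free_group)
  show ?case
  proof (cases "reduced (w @ w)")
    case True
    then show ?thesis
      using less.prems by (intro bexI[of _ "\<one>\<^bsub>F\<^esub>"] bexI[of _ w]) auto
  next
    case False
    then have ne: "w \<noteq> []" and hd: "hd w = inv_letter (last w)"
      using less.prems by (auto simp: reduced_append F_def carrier_free_group_iff)
    define y where "y = last w"
    obtain v where v: "w = v @ [y]" using ne unfolding y_def by (metis append_butlast_last_id)
    have "v \<noteq> []" using hd v unfolding y_def
      by (metis append_Nil inv_letter_neq(2) list.sel(1))
    then have "hd v = inv_letter y" using hd v unfolding y_def[symmetric] by simp
    then obtain m where m: "v = inv_letter y # m"
      using \<open>v \<noteq> []\<close> by (metis list.collapse)
    have mc: "m \<in> carrier F" "[y] \<in> carrier F" "[inv_letter y] \<in> carrier F"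
      using less.prems v m by (auto simp: F_def carrier_free_group_iff reduced_append reduced_Cons)
    have inv_y: "inv\<^bsub>F\<^esub> [y] = [inv_letter y]"
      using mc inv_free_group[of "[y]" A] by (simp add: F_def)
    have red: "reduced (v @ [y])" "reduced v"
      using less.prems v by (simp_all add: F_def carrier_free_group_iff reduced_append)
    have "v \<otimes>\<^bsub>F\<^esub> [y] = w" "[inv_letter y] \<otimes>\<^bsub>F\<^esub> m = v"
      using red v m mult_free_group_append[of v "[y]" A]
        mult_free_group_append[of "[inv_letter y]" m A]
      by (simp_all add: F_def)
    then have w: "w = inv\<^bsub>F\<^esub> [y] \<otimes>\<^bsub>F\<^esub> m \<otimes>\<^bsub>F\<^esub> [y]"
      by (simp add: inv_y)
    obtain u c where "u \<in> carrier F" "c \<in> carrier F" "reduced (c @ c)"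
      "m = inv\<^bsub>F\<^esub> u \<otimes>\<^bsub>F\<^esub> c \<otimes>\<^bsub>F\<^esub> u"
      using less.hyps[of m] mc(1) v m by auto
    then show ?thesis
      using w mc by (intro bexI[of _ "u \<otimes>\<^bsub>F\<^esub> [y]"] bexI[of _ c]) (auto simp: cancel_simps)
  qed
qed

section \<open>Products of two conjugated letters\<close>

lemma mult_letters_commute:
  "[(a, s)] \<otimes>\<^bsub>free_group A\<^esub> [(a, t)] = [(a, t)] \<otimes>\<^bsub>free_group A\<^esub> [(a, s)]"
  by (simp add: mult_free_group)

lemma replicate_closed: "a \<in> A \<Longrightarrow> replicate n (a, s) \<in> carrier (free_group A)"
  by (induction n) (auto simp: carrier_free_group_iff reduced_Cons hd_replicate)

text \<open>Powers of \<open>a\<close> commute with the letter. Hence a conjugator of a letter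
  matters only up to powers of that letter on its left, the freedom used in
  \<open>common_conjugator\<close>.\<close>

lemma conj_replicate:
  fixes A defines "F \<equiv> free_group A"
  assumes "a \<in> A"
  shows "inv\<^bsub>F\<^esub> (replicate n (a, t)) \<otimes>\<^bsub>F\<^esub> [(a, s)] \<otimes>\<^bsub>F\<^esub> replicate n (a, t) = [(a, s)]"
proof -
  interpret group F unfolding F_def by (rule group_free_group)
  have cl: "[(a, s)] \<in> carrier F" "[(a, t)] \<in> carrier F"
    "\<And>n. replicate n (a, t) \<in> carrier F"
    using assms generator_closed[of a A] replicate_closed[of a A] by (auto simp: F_def)
  have "[(a, s)] \<otimes>\<^bsub>F\<^esub> replicate n (a, t) = replicate n (a, t) \<otimes>\<^bsub>F\<^esub> [(a, s)]" for n
  proof (induction n)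
    case 0
    then show ?case using cl(1) r_one[of "[(a, s)]"] l_one[of "[(a, s)]"] by (simp add: F_def)
  next
    case (Suc n)
    have rep: "replicate (Suc n) (a, t) = [(a, t)] \<otimes>\<^bsub>F\<^esub> replicate n (a, t)"
      using cl(3)[of "Suc n"] mult_free_group_append[of "[(a, t)]" "replicate n (a, t)" A]
      by (simp add: F_def carrier_free_group_iff)
    have "[(a, s)] \<otimes>\<^bsub>F\<^esub> replicate (Suc n) (a, t)
        = ([(a, s)] \<otimes>\<^bsub>F\<^esub> [(a, t)]) \<otimes>\<^bsub>F\<^esub> replicate n (a, t)"
      unfolding rep using cl by (simp only: m_assoc)
    also have "\<dots> = [(a, t)] \<otimes>\<^bsub>F\<^esub> ([(a, s)] \<otimes>\<^bsub>F\<^esub> replicate n (a, t))"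
      unfolding F_def mult_letters_commute[of A a s t] using cl unfolding F_def[symmetric]
      by (simp only: m_assoc)
    also have "\<dots> = replicate (Suc n) (a, t) \<otimes>\<^bsub>F\<^esub> [(a, s)]"
      unfolding rep Suc using cl by (simp only: m_assoc)
    finally show ?case .
  qed
  then show ?thesis
    using cl by (simp add: m_assoc inv_mult_cancel_left)
qed

text \<open>If no letter of \<open>w\<close> can be absorbed, then the word \<open>a w\<^sup>-\<^sup>1 b w\<close> is cyclically reduced of length
  \<open>2 + 2 |w|\<close>.\<close>

lemma stable_length_two_imp:
  fixes A defines "F \<equiv> free_group A"
  assumes "a \<in> A" "b \<in> A" "a \<noteq> b" "w \<in> carrier F"
    and "stable_length_le A 2 ([(a, e)] \<otimes>\<^bsub>F\<^esub> inv\<^bsub>F\<^esub> w \<otimes>\<^bsub>F\<^esub> [(b, d)] \<otimes>\<^bsub>F\<^esub> w)"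
  shows "\<exists>i s j t. w = replicate i (b, s) @ replicate j (a, t)"
  using assms(5,6)
proof (induction "length w" arbitrary: w rule: less_induct)
  case less
  interpret group F unfolding F_def by (rule group_free_group)
  have gen: "[(a, s)] \<in> carrier F" "[(b, s)] \<in> carrier F" for s
    using assms(2,3) generator_closed by (auto simp: F_def)
  consider (Nil) "w = []" | (b) v s where "w = (b, s) # v" | (a) v s where "w = v @ [(a, s)]"
    | (other) "w \<noteq> []" "fst (hd w) \<noteq> b" "fst (last w) \<noteq> a"
    by (metis append_butlast_last_id list.collapse prod.collapse)
  then show ?case
  proof cases
    case Nil
    then show ?thesis by (metis append.right_neutral replicate_0)
  next
    \<comment> \<open>A leading \<open>b\<close>-letter of \<open>w\<close> commutes with
      \<open>(b, d)\<close>, so dropping it leaves the product unchanged.\<close>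
    case (b v s)
    have v: "v \<in> carrier F" and w: "w = [(b, s)] \<otimes>\<^bsub>F\<^esub> v"
      using less.prems(1) b mult_free_group_append[of "[(b, s)]" v A]
      by (auto simp: F_def carrier_free_group_iff reduced_Cons)
    have "inv\<^bsub>F\<^esub> [(b, s)] \<otimes>\<^bsub>F\<^esub> ([(b, d)] \<otimes>\<^bsub>F\<^esub> ([(b, s)] \<otimes>\<^bsub>F\<^esub> v)) = [(b, d)] \<otimes>\<^bsub>F\<^esub> v"
      using conj_replicate[OF assms(3), where n = 1 and t = s and s = d] gen v
      by (simp add: m_assoc flip: F_def) (metis gen inv_closed m_assoc m_closed)
    then have "[(a, e)] \<otimes>\<^bsub>F\<^esub> inv\<^bsub>F\<^esub> w \<otimes>\<^bsub>F\<^esub> [(b, d)] \<otimes>\<^bsub>F\<^esub> w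
        = [(a, e)] \<otimes>\<^bsub>F\<^esub> inv\<^bsub>F\<^esub> v \<otimes>\<^bsub>F\<^esub> [(b, d)] \<otimes>\<^bsub>F\<^esub> v"
      unfolding w using gen v by (simp add: m_assoc inv_mult_group)
    then obtain i s' j t where v_eq: "v = replicate i (b, s') @ replicate j (a, t)"
      using less.hyps[of v] less.prems(2) v b by auto
    show ?thesis
    proof (cases "i = 0")
      case True
      then have "w = replicate 1 (b, s) @ replicate j (a, t)" using b v_eq by simp
      then show ?thesis by blast
    next
      case False
      then have "s' = s"
        using less.prems(1) b v_eq by (cases i) (auto simp: F_def carrier_free_group_iff reduced_Cons)
      then have "w = replicate (Suc i) (b, s) @ replicate j (a, t)" using b v_eq by simp
      then show ?thesis by blast
    qed
  next
    \<comment> \<open>A trailing \<open>a\<close>-letter commutes with \<open>(a, e)\<close>, so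
      dropping it replaces the product by a conjugate.\<close>
    case (a v s)
    have v: "v \<in> carrier F" and w: "w = v \<otimes>\<^bsub>F\<^esub> [(a, s)]"
      using less.prems(1) a mult_free_group_append[of v "[(a, s)]" A]
      by (auto simp: F_def carrier_free_group_iff reduced_append)
    have inv_s: "inv\<^bsub>F\<^esub> [(a, s)] = [(a, \<not> s)]"
      using inv_free_group_generator[OF assms(2)] by (simp add: F_def)
    have com: "[(a, e)] \<otimes>\<^bsub>F\<^esub> inv\<^bsub>F\<^esub> [(a, s)] = inv\<^bsub>F\<^esub> [(a, s)] \<otimes>\<^bsub>F\<^esub> [(a, e)]"
      unfolding inv_s unfolding F_def by (rule mult_letters_commute)
    have "[(a, e)] \<otimes>\<^bsub>F\<^esub> inv\<^bsub>F\<^esub> w \<otimes>\<^bsub>F\<^esub> [(b, d)] \<otimes>\<^bsub>F\<^esub> w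
        = ([(a, e)] \<otimes>\<^bsub>F\<^esub> inv\<^bsub>F\<^esub> [(a, s)]) \<otimes>\<^bsub>F\<^esub> (inv\<^bsub>F\<^esub> v \<otimes>\<^bsub>F\<^esub> [(b, d)] \<otimes>\<^bsub>F\<^esub> v \<otimes>\<^bsub>F\<^esub> [(a, s)])"
      unfolding w using gen v by (simp add: m_assoc inv_mult_group)
    also have "\<dots> = inv\<^bsub>F\<^esub> [(a, s)] \<otimes>\<^bsub>F\<^esub>
        ([(a, e)] \<otimes>\<^bsub>F\<^esub> inv\<^bsub>F\<^esub> v \<otimes>\<^bsub>F\<^esub> [(b, d)] \<otimes>\<^bsub>F\<^esub> v) \<otimes>\<^bsub>F\<^esub> [(a, s)]"
      unfolding com using gen v by (simp add: m_assoc)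
    finally have "stable_length_le A 2 ([(a, e)] \<otimes>\<^bsub>F\<^esub> inv\<^bsub>F\<^esub> v \<otimes>\<^bsub>F\<^esub> [(b, d)] \<otimes>\<^bsub>F\<^esub> v)"
      using less.prems(2) gen v
        stable_length_le_conj[of "[(a, s)]" A "[(a, e)] \<otimes>\<^bsub>F\<^esub> inv\<^bsub>F\<^esub> v \<otimes>\<^bsub>F\<^esub> [(b, d)] \<otimes>\<^bsub>F\<^esub> v" 2]
      by (simp flip: F_def)
    then obtain i s' j t where v_eq: "v = replicate i (b, s') @ replicate j (a, t)"
      using less.hyps[of v] v a by auto
    show ?thesis
    proof (cases "j = 0")
      case True
      then have "w = replicate i (b, s') @ replicate 1 (a, s)" using a v_eq by simp
      then show ?thesis by blast
    next
      case False
      then have "t = s"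
        using less.prems(1) a v_eq by (auto simp: F_def carrier_free_group_iff reduced_append)
      then have "w = replicate i (b, s') @ replicate (Suc j) (a, s)"
        using a v_eq by (simp add: replicate_append_same)
      then show ?thesis by blast
    qed
  next
    case other
    let ?c = "(a, e) # inv_word w @ (b, d) # w"
    have red: "reduced w" using less.prems(1) by (simp add: F_def carrier_free_group_iff)
    have neq: "x \<noteq> inv_letter y" if "fst x \<noteq> fst y" for x y :: "'a \<times> bool"
      using that by auto
    \<comment> \<open>At each of the four junctions, the cyclic one included, letters of different
      generators meet.\<close>
    have cyc: "reduced (?c @ ?c)"
      using other assms(4) red reduced_inv_word[OF red]
      by (auto simp: reduced_append reduced_Cons hd_append hd_map hd_rev last_map last_rev
          intro!: neq dest!: arg_cong[where f = fst])
    have c: "reduced ?c" using cyc by (simp only: reduced_append)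
    then have "reduced (inv_word w @ (b, d) # w)" "reduced ((b, d) # w)"
      by (auto simp: reduced_Cons reduced_append)
    then have "?c = [(a, e)] \<otimes>\<^bsub>F\<^esub> (inv\<^bsub>F\<^esub> w \<otimes>\<^bsub>F\<^esub> ([(b, d)] \<otimes>\<^bsub>F\<^esub> w))"
      using c less.prems(1) mult_free_group_append[of "[(a, e)]" "inv_word w @ (b, d) # w" A]
        mult_free_group_append[of "inv_word w" "(b, d) # w" A]
        mult_free_group_append[of "[(b, d)]" w A]
      by (simp add: F_def inv_free_group)
    then have "stable_length_le A 2 ?c"
      using less.prems gen by (simp add: m_assoc)
    from stable_length_le_cyclically_reduced[OF cyc this] other show ?thesis by simp
  qed
qed

section \<open>Substitution automorphisms\<close>

text \<open>When \<open>v\<close> avoids \<open>x\<close>, this is a composite of Nielsen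
  transvections: it carries the standard basis to the one with \<open>x\<close> replaced by
  \<open>x v\<close>.\<close>

definition subst_gen :: "'a set \<Rightarrow> 'a \<Rightarrow> ('a \<times> bool) list \<Rightarrow> ('a \<times> bool) list \<Rightarrow> ('a \<times> bool) list" where
  "subst_gen A x v w = eval_word (free_group A)
    (map (apfst (\<lambda>a. if a = x then [(a, True)] \<otimes>\<^bsub>free_group A\<^esub> v else [(a, True)])) w)"

lemma subst_gen_hom:
  assumes "v \<in> carrier (free_group A)"
  shows "subst_gen A x v \<in> hom (free_group A) (free_group A)"
proof -
  interpret F: group "free_group A" by (rule group_free_group)
  let ?f = "\<lambda>a. if a = x then [(a, True)] \<otimes>\<^bsub>free_group A\<^esub> v else [(a, True)]"
  have "?f ` A \<subseteq> carrier (free_group A)"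
    using F.m_closed[OF generator_closed assms] generator_closed by auto
  from F.eval_word_map_hom[OF this] show ?thesis
    unfolding subst_gen_def .
qed

lemma subst_gen_generator:
  assumes "v \<in> carrier (free_group A)" "a \<in> A"
  shows "subst_gen A x v [(a, True)] =
    (if a = x then [(a, True)] \<otimes>\<^bsub>free_group A\<^esub> v else [(a, True)])"
proof -
  interpret F: group "free_group A" by (rule group_free_group)
  have "[(a, True)] \<otimes>\<^bsub>free_group A\<^esub> v \<in> carrier (free_group A)" "[(a, True)] \<in> carrier (free_group A)"
    using assms generator_closed by (metis F.m_closed)+
  then show ?thesis
    using F.r_one by (auto simp: subst_gen_def F.eval_word_Cons F.eval_word_Nil)
qed

lemma id_hom: "(\<lambda>w. w) \<in> hom G G"
  by (simp add: hom_def)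

lemma subst_gen_fixed:
  assumes "v \<in> carrier (free_group A)" "w \<in> carrier (free_group A)" "x \<notin> fst ` set w"
  shows "subst_gen A x v w = w"
proof (rule hom_free_group_eqI[OF group_free_group subst_gen_hom[OF assms(1)] id_hom assms(2)])
  fix a assume a: "a \<in> fst ` set w"
  with assms(2) have "a \<in> A" by (auto simp: carrier_free_group_iff)
  with a assms(3) subst_gen_generator[OF assms(1), of a x] show "subst_gen A x v [(a, True)] = [(a, True)]"
    by auto
qed

text \<open>Since \<open>x\<close> does not occur in \<open>v\<close>, the second substitution fixes
  \<open>v\<close>, and on \<open>x\<close> the factors \<open>inv v\<close> and \<open>v\<close>
  cancel.\<close>

lemma subst_gen_inverse:
  fixes A defines "F \<equiv> free_group A"
  assumes "v \<in> carrier F" "x \<notin> fst ` set v" "w \<in> carrier F"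
  shows "subst_gen A x (inv\<^bsub>F\<^esub> v) (subst_gen A x v w) = w"
proof -
  interpret group F unfolding F_def by (rule group_free_group)
  have v: "inv\<^bsub>F\<^esub> v \<in> carrier F" using assms(2) by simp
  have hom: "subst_gen A x v \<in> hom F F" "subst_gen A x (inv\<^bsub>F\<^esub> v) \<in> hom F F"
    using subst_gen_hom assms(2) v by (auto simp: F_def)
  have comp: "(\<lambda>w. subst_gen A x (inv\<^bsub>F\<^esub> v) (subst_gen A x v w)) \<in> hom F F"
    using hom by (auto simp: hom_def Pi_iff)
  show ?thesis
  proof (rule hom_free_group_eqI[of F _ A "\<lambda>w. w", folded F_def,
        OF group_axioms comp id_hom assms(4)])
    fix a assume "a \<in> fst ` set w"
    with assms(4) have a: "a \<in> A" by (auto simp: carrier_free_group_iff F_def)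
    then have gen: "[(a, True)] \<in> carrier F" by (simp add: generator_closed F_def)
    note sg = subst_gen_generator[of v A a x, folded F_def, OF assms(2) a]
      subst_gen_generator[of "inv\<^bsub>F\<^esub> v" A a x, folded F_def, OF v a]
    show "subst_gen A x (inv\<^bsub>F\<^esub> v) (subst_gen A x v [(a, True)]) = [(a, True)]"
    proof (cases "a = x")
      case True
      have "subst_gen A x (inv\<^bsub>F\<^esub> v) (subst_gen A x v [(a, True)])
          = subst_gen A x (inv\<^bsub>F\<^esub> v) [(a, True)] \<otimes>\<^bsub>F\<^esub> subst_gen A x (inv\<^bsub>F\<^esub> v) v"
        using True sg(1) hom_mult[OF hom(2) gen assms(2)] by simp
      also have "\<dots> = [(a, True)] \<otimes>\<^bsub>F\<^esub> inv\<^bsub>F\<^esub> v \<otimes>\<^bsub>F\<^esub> v"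
        using True sg(2) subst_gen_fixed[of "inv\<^bsub>F\<^esub> v" A v x] v assms(2,3) by (simp add: F_def)
      finally show ?thesis using gen assms(2) r_one[OF gen] by (simp add: m_assoc)
    next
      case False
      then show ?thesis using sg by simp
    qed
  qed
qed

lemma
  fixes A defines "F \<equiv> free_group A"
  assumes "v \<in> carrier F" "x \<notin> fst ` set v"
  shows subst_gen_iso: "subst_gen A x v \<in> iso F F"
    and inv_into_subst_gen:
      "w \<in> carrier F \<Longrightarrow> inv_into (carrier F) (subst_gen A x v) w = subst_gen A x (inv\<^bsub>F\<^esub> v) w"
proof -
  interpret group F unfolding F_def by (rule group_free_group)
  have v: "inv\<^bsub>F\<^esub> v \<in> carrier F" "x \<notin> fst ` set (inv\<^bsub>F\<^esub> v)"
    using assms(2,3) inv_closed[OF assms(2)] inv_free_group[of v A]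
    by (simp_all add: F_def image_image)
  have hom: "subst_gen A x v \<in> hom F F" "subst_gen A x (inv\<^bsub>F\<^esub> v) \<in> hom F F"
    using subst_gen_hom assms(2) v by (auto simp: F_def)
  have left: "subst_gen A x (inv\<^bsub>F\<^esub> v) (subst_gen A x v w) = w" if "w \<in> carrier F" for w
    using subst_gen_inverse[of v A x w] assms(2,3) that by (simp add: F_def)
  have right: "subst_gen A x v (subst_gen A x (inv\<^bsub>F\<^esub> v) w) = w" if "w \<in> carrier F" for w
    using subst_gen_inverse[of "inv\<^bsub>F\<^esub> v" A x w, folded F_def, OF v that] assms(2) by simp
  have closed: "subst_gen A x v w \<in> carrier F" "subst_gen A x (inv\<^bsub>F\<^esub> v) w \<in> carrier F"
    if "w \<in> carrier F" for w
    using hom that by (auto simp: hom_def)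
  have bij: "bij_betw (subst_gen A x v) (carrier F) (carrier F)"
    by (rule bij_betw_byWitness[where f' = "subst_gen A x (inv\<^bsub>F\<^esub> v)"])
      (use left right closed in auto)
  then show "subst_gen A x v \<in> iso F F" using hom by (simp add: iso_def)
  show "inv_into (carrier F) (subst_gen A x v) w = subst_gen A x (inv\<^bsub>F\<^esub> v) w"
    if "w \<in> carrier F"
    using bij right[OF that] closed(2)[OF that] by (metis bij_betw_inv_into_left)
qed

section \<open>Automorphisms not increasing stable lengths\<close>

text \<open>Here \<open>length (\<theta>\<^sup>-\<^sup>1 g)\<close> is the word length of \<open>g\<close> in the basis \<open>\<theta>(A)\<close>.\<close>

definition stable_nonexpanding :: "'a set \<Rightarrow> (('a \<times> bool) list \<Rightarrow> ('a \<times> bool) list) \<Rightarrow> bool" where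
  "stable_nonexpanding A \<psi> \<longleftrightarrow> (\<forall>\<theta>\<in>iso (free_group A) (free_group A). \<exists>C.
    \<forall>w\<in>carrier (free_group A).
      length (inv_into (carrier (free_group A)) \<theta> (\<psi> (\<theta> w))) \<le> length w + C)"

context
  fixes A :: "'a set" and F and \<psi>
  defines "F \<equiv> free_group A"
  assumes iso: "\<psi> \<in> iso F F" and nonexp: "stable_nonexpanding A \<psi>"
begin

interpretation group F unfolding F_def by (rule group_free_group)

lemma \<psi>_hom: "\<psi> \<in> hom F F"
  using iso by (simp add: iso_def)

interpretation \<psi>: group_hom F F \<psi>
  using \<psi>_hom group_axioms by (simp add: group_hom_def group_hom_axioms_def)

lemma gen_closed: "a \<in> A \<Longrightarrow> [(a, s)] \<in> carrier F"
  by (simp add: F_def generator_closed)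

text \<open>Non-expansion is applied to powers of \<open>w\<close>: the conjugated map is a
  homomorphism, and the \<open>n\<close>-th power of \<open>w\<close> has length at most
  \<open>n\<close> times that of \<open>w\<close>.\<close>

lemma stable_length_subst_gen:
  assumes "v \<in> carrier F" "x \<notin> fst ` set v" "w \<in> carrier F"
  shows "stable_length_le A (length w) (subst_gen A x (inv\<^bsub>F\<^esub> v) (\<psi> (subst_gen A x v w)))"
proof -
  let ?\<theta> = "subst_gen A x v" and ?\<eta> = "subst_gen A x (inv\<^bsub>F\<^esub> v)"
  have hom: "?\<theta> \<in> hom F F" "?\<eta> \<in> hom F F"
    using subst_gen_hom assms(1) inv_closed[OF assms(1)] by (auto simp: F_def)
  interpret t: group_hom F F ?\<theta>
    using hom group_axioms by (simp add: group_hom_def group_hom_axioms_def)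
  interpret e: group_hom F F ?\<eta>
    using hom group_axioms by (simp add: group_hom_def group_hom_axioms_def)
  obtain C where "\<And>w. w \<in> carrier F \<Longrightarrow> length (inv_into (carrier F) ?\<theta> (\<psi> (?\<theta> w))) \<le> length w + C"
    using nonexp subst_gen_iso[of v A x, folded F_def, OF assms(1,2)]
    unfolding stable_nonexpanding_def F_def by blast
  then have C: "length (?\<eta> (\<psi> (?\<theta> w))) \<le> length w + C" if "w \<in> carrier F" for w
    using inv_into_subst_gen[of v A x, folded F_def, OF assms(1,2)] that by fastforce
  have "length (?\<eta> (\<psi> (?\<theta> w)) [^]\<^bsub>F\<^esub> n) \<le> length w * n + C" for n :: nat
  proof -
    have "?\<eta> (\<psi> (?\<theta> w)) [^]\<^bsub>F\<^esub> n = ?\<eta> (\<psi> (?\<theta> (w [^]\<^bsub>F\<^esub> n)))"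
      using assms(3) by (simp add: t.hom_nat_pow \<psi>.hom_nat_pow e.hom_nat_pow)
    then show ?thesis
      using C[OF nat_pow_closed[OF assms(3), of n]]
        length_nat_pow_free_group[of A w n, folded F_def] by simp
  qed
  then show ?thesis unfolding stable_length_le_def F_def by blast
qed

lemma stable_length_image:
  assumes "w \<in> carrier F"
  shows "stable_length_le A (length w) (\<psi> w)"
proof -
  have "(\<lambda>w. w) \<in> iso F F" by (simp add: iso_def hom_def bij_betw_def)
  then obtain C where C: "\<And>w. w \<in> carrier F \<Longrightarrow>
      length (inv_into (carrier F) (\<lambda>w. w) (\<psi> w)) \<le> length w + C"
    using nonexp unfolding stable_nonexpanding_def F_def by blast
  have "inv_into (carrier F) (\<lambda>w. w) (\<psi> w) = \<psi> w" if "w \<in> carrier F" for w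
    using that f_inv_into_f[of "\<psi> w" "\<lambda>w. w" "carrier F"] by simp
  with C have C: "length (\<psi> w) \<le> length w + C" if "w \<in> carrier F" for w
    using that by fastforce
  have "length (\<psi> w [^]\<^bsub>F\<^esub> n) \<le> length w * n + C" for n :: nat
    using C[OF nat_pow_closed[OF assms, of n]] \<psi>.hom_nat_pow[OF assms, of n]
      length_nat_pow_free_group[of A w n, folded F_def] by simp
  then show ?thesis unfolding stable_length_le_def F_def by blast
qed

section \<open>Images of the generators, their conjugators and signs\<close>

text \<open>The cyclically reduced core of \<open>\<psi> a\<close> has length at most 1 and is
  nontrivial by injectivity, so it is a single letter, on \<open>b\<close> say. If \<open>b\<close>
  differed from \<open>a\<close>, then in the basis with \<open>b\<close> replaced by
  \<open>ba\<close> the generator \<open>a\<close> would keep length 1, while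
  \<open>b = (ba) a^-1\<close> has translation length 2.\<close>

lemma image_generator:
  assumes a: "a \<in> A"
  shows "\<exists>u\<in>carrier F. \<exists>s. \<psi> [(a, True)] = inv\<^bsub>F\<^esub> u \<otimes>\<^bsub>F\<^esub> [(a, s)] \<otimes>\<^bsub>F\<^esub> u"
proof -
  have ga: "[(a, True)] \<in> carrier F" using a by (rule gen_closed)
  obtain u c where u: "u \<in> carrier F" and c: "c \<in> carrier F" "reduced (c @ c)"
    and eq: "\<psi> [(a, True)] = inv\<^bsub>F\<^esub> u \<otimes>\<^bsub>F\<^esub> c \<otimes>\<^bsub>F\<^esub> u"
    using conj_cyclically_reduced[of "\<psi> [(a, True)]" A] \<psi>.hom_closed[OF ga]
    unfolding F_def by blast
  have "stable_length_le A 1 c"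
    using stable_length_image[OF ga] stable_length_le_conj[of u A c 1] u c(1) eq
    by (simp add: F_def)
  then have len: "length c \<le> 1" by (rule stable_length_le_cyclically_reduced[OF c(2)])
  have "c \<noteq> []"
  proof
    assume "c = []"
    then have "c = \<one>\<^bsub>F\<^esub>" by (simp add: F_def)
    then have "\<psi> [(a, True)] = \<psi> \<one>\<^bsub>F\<^esub>" using eq u by simp
    then have "[(a, True)] = \<one>\<^bsub>F\<^esub>"
      using iso ga one_closed unfolding iso_def bij_betw_def inj_on_def by blast
    then show False by (simp add: F_def)
  qed
  with len obtain b s where c_eq: "c = [(b, s)]"
    by (cases c) auto
  have b: "b \<in> A" using c(1) c_eq by (simp add: F_def carrier_free_group_iff)
  have "b = a"
  proof (rule ccontr)
    assume "b \<noteq> a"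
    let ?\<theta> = "subst_gen A b [(a, True)]" and ?\<eta> = "subst_gen A b (inv\<^bsub>F\<^esub> [(a, True)])"
    have inv_a: "inv\<^bsub>F\<^esub> [(a, True)] = [(a, False)]"
      using inv_free_group_generator[OF a] by (simp add: F_def)
    have "?\<eta> \<in> hom F F"
      using subst_gen_hom inv_closed[OF ga] by (simp add: F_def)
    then interpret e: group_hom F F ?\<eta>
      using group_axioms by (simp add: group_hom_def group_hom_axioms_def)
    have "?\<theta> [(a, True)] = [(a, True)]"
      using subst_gen_fixed[of "[(a, True)]" A "[(a, True)]" b] ga \<open>b \<noteq> a\<close> by (simp add: F_def)
    then have "stable_length_le A 1 (?\<eta> (inv\<^bsub>F\<^esub> u \<otimes>\<^bsub>F\<^esub> c \<otimes>\<^bsub>F\<^esub> u))"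
      using stable_length_subst_gen[of "[(a, True)]" b "[(a, True)]"] ga \<open>b \<noteq> a\<close> eq by simp
    then have stable: "stable_length_le A 1 (?\<eta> c)"
      using stable_length_le_conj[of "?\<eta> u" A "?\<eta> c" 1, folded F_def] u c(1) by simp
    have "?\<eta> [(b, True)] = [(b, True)] \<otimes>\<^bsub>F\<^esub> [(a, False)]"
      using subst_gen_generator[of "inv\<^bsub>F\<^esub> [(a, True)]" A b b, folded F_def, OF inv_closed[OF ga] b]
        inv_a by simp
    also have "\<dots> = [(b, True), (a, False)]"
      using \<open>b \<noteq> a\<close> by (simp add: F_def mult_free_group)
    finally have True: "?\<eta> [(b, True)] = [(b, True), (a, False)]" .
    have "[(b, False)] = inv\<^bsub>F\<^esub> [(b, True)]"
      using inv_free_group_generator[OF b] by (simp add: F_def)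
    then have "?\<eta> [(b, False)] = inv\<^bsub>F\<^esub> [(b, True), (a, False)]"
      using e.hom_inv[OF gen_closed[OF b, of True]] True by simp
    also have "\<dots> = [(a, True), (b, False)]"
      using \<open>b \<noteq> a\<close> a b inv_free_group[of "[(b, True), (a, False)]" A]
      by (simp add: F_def carrier_free_group_iff reduced_Cons)
    finally have False: "?\<eta> [(b, False)] = [(a, True), (b, False)]" .
    have "reduced (?\<eta> c @ ?\<eta> c)" "length (?\<eta> c) = 2"
      using True False \<open>b \<noteq> a\<close> unfolding c_eq by (cases s; simp add: reduced_Cons)+
    with stable_length_le_cyclically_reduced[OF _ stable] show False by simp
  qed
  with eq c_eq u show ?thesis by blast
qed

text \<open>Up to conjugation by \<open>u\<close>, the image of the product \<open>ab\<close> is the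
  word treated in \<open>stable_length_two_imp\<close> with \<open>w\<close> the quotient of the
  conjugators, and its translation length is at most 2.\<close>

lemma conj_quotient:
  assumes a: "a \<in> A" "u \<in> carrier F" "\<psi> [(a, True)] = inv\<^bsub>F\<^esub> u \<otimes>\<^bsub>F\<^esub> [(a, e)] \<otimes>\<^bsub>F\<^esub> u"
    and b: "b \<in> A" "v \<in> carrier F" "\<psi> [(b, True)] = inv\<^bsub>F\<^esub> v \<otimes>\<^bsub>F\<^esub> [(b, d)] \<otimes>\<^bsub>F\<^esub> v"
    and "a \<noteq> b"
  shows "\<exists>i s j t. v \<otimes>\<^bsub>F\<^esub> inv\<^bsub>F\<^esub> u = replicate i (b, s) @ replicate j (a, t)"
proof -
  let ?w = "v \<otimes>\<^bsub>F\<^esub> inv\<^bsub>F\<^esub> u"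
  let ?x = "[(a, e)] \<otimes>\<^bsub>F\<^esub> inv\<^bsub>F\<^esub> ?w \<otimes>\<^bsub>F\<^esub> [(b, d)] \<otimes>\<^bsub>F\<^esub> ?w"
  have gen: "[(a, s)] \<in> carrier F" "[(b, s)] \<in> carrier F" for s
    using a(1) b(1) by (auto intro: gen_closed)
  have ab: "[(a, True)] \<otimes>\<^bsub>F\<^esub> [(b, True)] = [(a, True), (b, True)]"
    by (simp add: F_def mult_free_group)
  have "\<psi> ([(a, True)] \<otimes>\<^bsub>F\<^esub> [(b, True)]) = inv\<^bsub>F\<^esub> u \<otimes>\<^bsub>F\<^esub> ?x \<otimes>\<^bsub>F\<^esub> u"
    using a(2,3) b(2,3) gen by (simp add: cancel_simps)
  moreover have "stable_length_le A 2 (\<psi> ([(a, True)] \<otimes>\<^bsub>F\<^esub> [(b, True)]))"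
    using stable_length_image[OF m_closed[OF gen(1)[of True] gen(2)[of True]]]
    unfolding ab by (simp add: numeral_2_eq_2)
  moreover have "?x \<in> carrier F" using gen a(2) b(2) by simp
  ultimately have "stable_length_le A 2 ?x"
    using stable_length_le_conj[of u A ?x 2, folded F_def] a(2) by simp
  then show ?thesis
    using stable_length_two_imp[of a A b ?w, folded F_def] a(1,2) b(1,2) \<open>a \<noteq> b\<close> by simp
qed

lemma common_conjugator:
  assumes "card A > 2"
  shows "\<exists>u\<in>carrier F. \<forall>c\<in>A. \<exists>s. \<psi> [(c, True)] = inv\<^bsub>F\<^esub> u \<otimes>\<^bsub>F\<^esub> [(c, s)] \<otimes>\<^bsub>F\<^esub> u"
proof -
  obtain a b where ab: "a \<in> A" "b \<in> A" "a \<noteq> b"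
    using assms by (metis card_le_Suc0_iff_eq card.infinite not_less_zero not_less_eq
        numeral_2_eq_2 Suc_lessD le_simps(2) not_le)
  obtain u e where u: "u \<in> carrier F" "\<psi> [(a, True)] = inv\<^bsub>F\<^esub> u \<otimes>\<^bsub>F\<^esub> [(a, e)] \<otimes>\<^bsub>F\<^esub> u"
    using image_generator[OF ab(1)] by blast
  obtain v d where v: "v \<in> carrier F" "\<psi> [(b, True)] = inv\<^bsub>F\<^esub> v \<otimes>\<^bsub>F\<^esub> [(b, d)] \<otimes>\<^bsub>F\<^esub> v"
    using image_generator[OF ab(2)] by blast
  obtain i s j t where vu: "v \<otimes>\<^bsub>F\<^esub> inv\<^bsub>F\<^esub> u = replicate i (b, s) @ replicate j (a, t)"
    using conj_quotient[OF ab(1) u ab(2) v ab(3)] by blast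
  define \<alpha> where "\<alpha> = replicate j (a, t)"
  define \<beta> where "\<beta> = replicate i (b, s)"
  \<comment> \<open>\<open>u0\<close> differs from \<open>u\<close> by a power of \<open>a\<close>
    and from \<open>v\<close> by a power of \<open>b\<close>, both on the left, so it conjugates
    correctly for both generators.\<close>
  define u0 where "u0 = \<alpha> \<otimes>\<^bsub>F\<^esub> u"
  have cl: "\<alpha> \<in> carrier F" "\<beta> \<in> carrier F" "u0 \<in> carrier F"
    using replicate_closed[OF ab(1)] replicate_closed[OF ab(2)] u
    by (auto simp: \<alpha>_def \<beta>_def u0_def F_def[symmetric])
  have gen: "[(a, s)] \<in> carrier F" "[(b, s)] \<in> carrier F" for s
    using ab by (auto intro: gen_closed)
  have "v \<otimes>\<^bsub>F\<^esub> inv\<^bsub>F\<^esub> u \<in> carrier F" using u v by simp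
  then have "v \<otimes>\<^bsub>F\<^esub> inv\<^bsub>F\<^esub> u = \<beta> \<otimes>\<^bsub>F\<^esub> \<alpha>"
    using mult_free_group_append[of \<beta> \<alpha> A] unfolding vu
    by (simp add: \<alpha>_def \<beta>_def F_def carrier_free_group_iff)
  then have v_eq: "v = \<beta> \<otimes>\<^bsub>F\<^esub> \<alpha> \<otimes>\<^bsub>F\<^esub> u"
    using u v cl by (metis inv_solve_right' m_closed)
  have \<alpha>: "inv\<^bsub>F\<^esub> \<alpha> \<otimes>\<^bsub>F\<^esub> [(a, e)] \<otimes>\<^bsub>F\<^esub> \<alpha> = [(a, e)]"
    using conj_replicate[OF ab(1)] by (simp add: \<alpha>_def F_def)
  have \<beta>: "inv\<^bsub>F\<^esub> \<beta> \<otimes>\<^bsub>F\<^esub> [(b, d)] \<otimes>\<^bsub>F\<^esub> \<beta> = [(b, d)]"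
    using conj_replicate[OF ab(2)] by (simp add: \<beta>_def F_def)
  have "inv\<^bsub>F\<^esub> u0 \<otimes>\<^bsub>F\<^esub> [(a, e)] \<otimes>\<^bsub>F\<^esub> u0
      = inv\<^bsub>F\<^esub> u \<otimes>\<^bsub>F\<^esub> (inv\<^bsub>F\<^esub> \<alpha> \<otimes>\<^bsub>F\<^esub> [(a, e)] \<otimes>\<^bsub>F\<^esub> \<alpha>) \<otimes>\<^bsub>F\<^esub> u"
    using cl u gen unfolding u0_def by (simp add: cancel_simps)
  then have a0: "\<psi> [(a, True)] = inv\<^bsub>F\<^esub> u0 \<otimes>\<^bsub>F\<^esub> [(a, e)] \<otimes>\<^bsub>F\<^esub> u0"
    unfolding \<alpha> u(2) ..
  have "inv\<^bsub>F\<^esub> v \<otimes>\<^bsub>F\<^esub> [(b, d)] \<otimes>\<^bsub>F\<^esub> v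
      = inv\<^bsub>F\<^esub> u0 \<otimes>\<^bsub>F\<^esub> (inv\<^bsub>F\<^esub> \<beta> \<otimes>\<^bsub>F\<^esub> [(b, d)] \<otimes>\<^bsub>F\<^esub> \<beta>) \<otimes>\<^bsub>F\<^esub> u0"
    using cl u gen unfolding u0_def v_eq by (simp add: cancel_simps)
  then have b0: "\<psi> [(b, True)] = inv\<^bsub>F\<^esub> u0 \<otimes>\<^bsub>F\<^esub> [(b, d)] \<otimes>\<^bsub>F\<^esub> u0"
    unfolding \<beta> v(2) .
  have "\<exists>s. \<psi> [(c, True)] = inv\<^bsub>F\<^esub> u0 \<otimes>\<^bsub>F\<^esub> [(c, s)] \<otimes>\<^bsub>F\<^esub> u0" if c: "c \<in> A" for c
  proof (cases "c = a \<or> c = b")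
    case True
    then show ?thesis using a0 b0 by blast
  next
    case False
    obtain w r where w: "w \<in> carrier F" "\<psi> [(c, True)] = inv\<^bsub>F\<^esub> w \<otimes>\<^bsub>F\<^esub> [(c, r)] \<otimes>\<^bsub>F\<^esub> w"
      using image_generator[OF c] by blast
    let ?x = "w \<otimes>\<^bsub>F\<^esub> inv\<^bsub>F\<^esub> u0"
    obtain i s j t where ac: "?x = replicate i (c, s) @ replicate j (a, t)"
      using conj_quotient[OF ab(1) cl(3) a0 c w] False by blast
    obtain k s' l t' where bc: "?x = replicate k (c, s') @ replicate l (b, t')"
      using conj_quotient[OF ab(2) cl(3) b0 c w] False by blast
    \<comment> \<open>The quotient is a \<open>c\<close>-power times an \<open>a\<close>-power and
      also a \<open>c\<close>-power times a \<open>b\<close>-power; comparing letters leaves only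
      the \<open>c\<close>-power, which conjugation of \<open>c\<close> absorbs.\<close>
    have "(a, t) \<notin> set ?x" unfolding bc using False ab(3) by auto
    then have "j = 0" unfolding ac by auto
    then have x: "?x = replicate i (c, s)" using ac by simp
    then have w_eq: "w = replicate i (c, s) \<otimes>\<^bsub>F\<^esub> u0"
      using w(1) cl(3) by (metis inv_solve_right' m_closed inv_closed)
    have rep: "replicate i (c, s) \<in> carrier F" "[(c, r)] \<in> carrier F"
      using replicate_closed[OF c] gen_closed[OF c] by (auto simp: F_def)
    have "inv\<^bsub>F\<^esub> w \<otimes>\<^bsub>F\<^esub> [(c, r)] \<otimes>\<^bsub>F\<^esub> w = inv\<^bsub>F\<^esub> u0 \<otimes>\<^bsub>F\<^esub>
        (inv\<^bsub>F\<^esub> (replicate i (c, s)) \<otimes>\<^bsub>F\<^esub> [(c, r)] \<otimes>\<^bsub>F\<^esub> replicate i (c, s)) \<otimes>\<^bsub>F\<^esub> u0"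
      using cl rep unfolding w_eq by (simp add: cancel_simps)
    also have "inv\<^bsub>F\<^esub> (replicate i (c, s)) \<otimes>\<^bsub>F\<^esub> [(c, r)] \<otimes>\<^bsub>F\<^esub> replicate i (c, s) = [(c, r)]"
      using conj_replicate[OF c] by (simp add: F_def)
    finally show ?thesis unfolding w(2) by blast
  qed
  with cl(3) show ?thesis by blast
qed

text \<open>If \<open>\<psi> a\<close> were conjugate to the inverse of \<open>a\<close>, then in a basis containing \<open>abc\<close> the image of
  \<open>abc\<close> would have translation length 5.\<close>

lemma conjugator_sign:
  assumes u: "u \<in> carrier F"
    and abc: "a \<in> A" "b \<in> A" "c \<in> A" "a \<noteq> b" "a \<noteq> c" "b \<noteq> c"
    and \<psi>: "\<psi> [(a, True)] = inv\<^bsub>F\<^esub> u \<otimes>\<^bsub>F\<^esub> [(a, s)] \<otimes>\<^bsub>F\<^esub> u"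
      "\<psi> [(b, True)] = inv\<^bsub>F\<^esub> u \<otimes>\<^bsub>F\<^esub> [(b, t)] \<otimes>\<^bsub>F\<^esub> u"
      "\<psi> [(c, True)] = inv\<^bsub>F\<^esub> u \<otimes>\<^bsub>F\<^esub> [(c, r)] \<otimes>\<^bsub>F\<^esub> u"
  shows s
proof (rule ccontr)
  assume "\<not> s"
  \<comment> \<open>Two letters are needed: with \<open>b\<close> alone, the image b a^-1 b^t would
    cyclically reduce to one letter for negative \<open>t\<close>. With \<open>bc\<close> the cyclic
    junction joins \<open>c\<close> to \<open>b\<close>, so nothing cancels for any signs
    \<open>t\<close> and \<open>r\<close>.\<close>
  let ?v = "[(b, True), (c, True)]"
  let ?\<theta> = "subst_gen A a ?v" and ?\<eta> = "subst_gen A a (inv\<^bsub>F\<^esub> ?v)"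
  have v: "?v \<in> carrier F" using abc by (simp add: F_def carrier_free_group_iff reduced_Cons)
  have inv_v: "inv\<^bsub>F\<^esub> ?v = [(c, False), (b, False)]"
    using v inv_free_group[of ?v A] by (simp add: F_def)
  have gen: "[(a, p)] \<in> carrier F" "[(b, p)] \<in> carrier F" "[(c, p)] \<in> carrier F" for p
    using abc by (auto intro: gen_closed)
  have "?\<eta> \<in> hom F F"
    using subst_gen_hom inv_closed[OF v] by (simp add: F_def)
  then interpret e: group_hom F F ?\<eta>
    using group_axioms by (simp add: group_hom_def group_hom_axioms_def)
  have v_eq: "?v = [(b, True)] \<otimes>\<^bsub>F\<^esub> [(c, True)]"
    by (simp add: F_def mult_free_group)
  have \<theta>a: "?\<theta> [(a, True)] = [(a, True)] \<otimes>\<^bsub>F\<^esub> ([(b, True)] \<otimes>\<^bsub>F\<^esub> [(c, True)])"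
    using subst_gen_generator[of ?v A a a, folded F_def, OF v abc(1)] v_eq by simp
  let ?x = "[(a, s)] \<otimes>\<^bsub>F\<^esub> [(b, t)] \<otimes>\<^bsub>F\<^esub> [(c, r)]"
  have "\<psi> (?\<theta> [(a, True)]) = inv\<^bsub>F\<^esub> u \<otimes>\<^bsub>F\<^esub> ?x \<otimes>\<^bsub>F\<^esub> u"
    unfolding \<theta>a using gen u \<psi> by (simp add: cancel_simps)
  then have "stable_length_le A 1 (?\<eta> (inv\<^bsub>F\<^esub> u \<otimes>\<^bsub>F\<^esub> ?x \<otimes>\<^bsub>F\<^esub> u))"
    using stable_length_subst_gen[of ?v a "[(a, True)]", OF v _ gen(1)] abc by simp
  then have stable: "stable_length_le A 1 (?\<eta> ?x)"
    using stable_length_le_conj[of "?\<eta> u" A "?\<eta> ?x" 1, folded F_def] u gen by simp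
  have "?\<eta> [(a, True)] = [(a, True)] \<otimes>\<^bsub>F\<^esub> [(c, False), (b, False)]"
    using subst_gen_generator[of "inv\<^bsub>F\<^esub> ?v" A a a, folded F_def, OF inv_closed[OF v] abc(1)]
      inv_v by simp
  also have "\<dots> = [(a, True), (c, False), (b, False)]"
    using abc by (simp add: F_def mult_free_group)
  finally have "?\<eta> [(a, True)] = [(a, True), (c, False), (b, False)]" .
  moreover have "[(a, False)] = inv\<^bsub>F\<^esub> [(a, True)]"
    using inv_free_group_generator[OF abc(1)] by (simp add: F_def)
  ultimately have "?\<eta> [(a, False)] = inv\<^bsub>F\<^esub> [(a, True), (c, False), (b, False)]"
    using e.hom_inv[OF gen(1)[of True]] by simp
  also have "\<dots> = [(b, True), (c, True), (a, False)]"
    using abc inv_free_group[of "[(a, True), (c, False), (b, False)]" A]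
    by (simp add: F_def carrier_free_group_iff reduced_Cons)
  finally have \<eta>a: "?\<eta> [(a, s)] = [(b, True), (c, True), (a, False)]" using \<open>\<not> s\<close> by simp
  have \<eta>bc: "?\<eta> [(b, t)] = [(b, t)]" "?\<eta> [(c, r)] = [(c, r)]"
    using subst_gen_fixed[of "inv\<^bsub>F\<^esub> ?v" A _ a, folded F_def, OF inv_closed[OF v]] gen abc
    by simp_all
  have "?\<eta> ?x = [(b, True), (c, True), (a, False)] \<otimes>\<^bsub>F\<^esub> [(b, t)] \<otimes>\<^bsub>F\<^esub> [(c, r)]"
    using gen \<eta>a \<eta>bc by simp
  also have "\<dots> = [(b, True), (c, True), (a, False), (b, t), (c, r)]"
    using abc by (simp add: F_def mult_free_group)
  finally have x: "?\<eta> ?x = [(b, True), (c, True), (a, False), (b, t), (c, r)]" .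
  have "reduced (?\<eta> ?x @ ?\<eta> ?x)" unfolding x using abc by (simp add: reduced_Cons)
  from stable_length_le_cyclically_reduced[OF this stable] show False unfolding x by simp
qed

lemma stable_nonexpanding_imp_inner:
  assumes card: "card A > 2"
  shows "\<exists>u\<in>carrier F. \<forall>g\<in>carrier F. \<psi> g = inv\<^bsub>F\<^esub> u \<otimes>\<^bsub>F\<^esub> g \<otimes>\<^bsub>F\<^esub> u"
proof -
  obtain u where u: "u \<in> carrier F"
    "\<And>c. c \<in> A \<Longrightarrow> \<exists>s. \<psi> [(c, True)] = inv\<^bsub>F\<^esub> u \<otimes>\<^bsub>F\<^esub> [(c, s)] \<otimes>\<^bsub>F\<^esub> u"
    using common_conjugator[OF card] by blast
  have gen: "\<psi> [(a, True)] = inv\<^bsub>F\<^esub> u \<otimes>\<^bsub>F\<^esub> [(a, True)] \<otimes>\<^bsub>F\<^esub> u" if a: "a \<in> A" for a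
  proof -
    have "finite A" using card by (metis card.infinite not_less_zero)
    then have "card (A - {a}) > 1" using card a by simp
    then obtain b where b: "b \<in> A" "b \<noteq> a" by (metis Diff_iff card_eq_0_iff ex_in_conv insertI1 not_less_zero)
    have "card (A - {a} - {b}) > 0" using \<open>card (A - {a}) > 1\<close> \<open>finite A\<close> b by simp
    then obtain c where c: "c \<in> A" "c \<noteq> a" "c \<noteq> b" by (metis Diff_iff card_gt_0_iff ex_in_conv insertI1)
    obtain s t r where "\<psi> [(a, True)] = inv\<^bsub>F\<^esub> u \<otimes>\<^bsub>F\<^esub> [(a, s)] \<otimes>\<^bsub>F\<^esub> u"
      "\<psi> [(b, True)] = inv\<^bsub>F\<^esub> u \<otimes>\<^bsub>F\<^esub> [(b, t)] \<otimes>\<^bsub>F\<^esub> u"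
      "\<psi> [(c, True)] = inv\<^bsub>F\<^esub> u \<otimes>\<^bsub>F\<^esub> [(c, r)] \<otimes>\<^bsub>F\<^esub> u"
      using u(2) a b c by metis
    moreover from this have s
      using conjugator_sign[OF u(1) a b(1) c(1)] b c by metis
    ultimately show ?thesis by simp
  qed
  have conj: "(\<lambda>g. inv\<^bsub>F\<^esub> u \<otimes>\<^bsub>F\<^esub> g \<otimes>\<^bsub>F\<^esub> u) \<in> hom F F"
    using u(1) by (intro homI) (auto simp: cancel_simps)
  have "\<psi> g = inv\<^bsub>F\<^esub> u \<otimes>\<^bsub>F\<^esub> g \<otimes>\<^bsub>F\<^esub> u" if g: "g \<in> carrier F" for g
  proof (rule hom_free_group_eqI[of F \<psi> A "\<lambda>g. inv\<^bsub>F\<^esub> u \<otimes>\<^bsub>F\<^esub> g \<otimes>\<^bsub>F\<^esub> u", folded F_def,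
        OF group_axioms \<psi>_hom conj g])
    fix a assume "a \<in> fst ` set g"
    with g have "a \<in> A" by (auto simp: F_def carrier_free_group_iff)
    then show "\<psi> [(a, True)] = inv\<^bsub>F\<^esub> u \<otimes>\<^bsub>F\<^esub> [(a, True)] \<otimes>\<^bsub>F\<^esub> u" by (rule gen)
  qed
  with u(1) show ?thesis by blast
qed

end

section \<open>Assembly of the two implications\<close>

theorem proposition6p6:
  fixes A :: "'a set"
    and \<phi> :: "('a \<times> bool) list \<Rightarrow> ('a \<times> bool) list"
  assumes "finite A"
    and "card A > 2"
    and "\<phi> \<in> auto (free_group A)"
  shows "(\<forall>A' p \<gamma> T d.
            is_basis (free_group A) A' \<and> p \<in> carrier (free_group A) \<and> \<gamma> > 0 \<and> T \<ge> 1 \<and>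
            d \<in> visual_metrics (free_group A) A' p \<gamma> T \<longrightarrow>
            lipschitz_condition (carrier (free_group A)) d \<phi>)
         \<longleftrightarrow> \<phi> \<in> Inn (free_group A)"
proof
  assume "\<phi> \<in> Inn (free_group A)"
  then show "\<forall>A' p \<gamma> T d.
      is_basis (free_group A) A' \<and> p \<in> carrier (free_group A) \<and> \<gamma> > 0 \<and> T \<ge> 1 \<and>
      d \<in> visual_metrics (free_group A) A' p \<gamma> T \<longrightarrow>
      lipschitz_condition (carrier (free_group A)) d \<phi>"
    using inner_imp_lipschitz_condition[OF group_free_group[of A]] unfolding Inn_def by blast
next
  assume lip: "\<forall>A' p \<gamma> T d.
      is_basis (free_group A) A' \<and> p \<in> carrier (free_group A) \<and> \<gamma> > 0 \<and> T \<ge> 1 \<and>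
      d \<in> visual_metrics (free_group A) A' p \<gamma> T \<longrightarrow>
      lipschitz_condition (carrier (free_group A)) d \<phi>"
  define F where "F = free_group A"
  interpret group F unfolding F_def by (rule group_free_group)
  define \<psi> where "\<psi> = inv_into (carrier F) \<phi>"
  have \<phi>: "\<phi> \<in> iso F F" "\<phi> \<in> extensional (carrier F)"
    using assms(3) by (auto simp: auto_def Bij_def iso_def F_def)
  then have bij: "bij_betw \<phi> (carrier F) (carrier F)" by (simp add: iso_def)
  have \<psi>: "\<psi> \<in> iso F F"
    unfolding \<psi>_def using \<phi>(1) by (rule iso_set_sym)
  have \<psi>_bij: "bij_betw \<psi> (carrier F) (carrier F)" using \<psi> by (simp add: iso_def)
  have \<phi>\<psi>: "\<phi> (\<psi> g) = g" if "g \<in> carrier F" for g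
    using bij that unfolding \<psi>_def by (simp add: bij_betw_inv_into_right)
  have \<psi>\<phi>: "\<psi> (\<phi> g) = g" if "g \<in> carrier F" for g
    using bij that unfolding \<psi>_def by (simp add: bij_betw_inv_into_left)
  have "stable_nonexpanding A \<psi>"
    unfolding stable_nonexpanding_def F_def[symmetric]
  proof
    fix \<theta> assume \<theta>: "\<theta> \<in> iso F F"
    let ?B = "(\<lambda>a. \<theta> [(a, True)]) ` A"
    let ?k = "word_in_basis F ?B"
    have \<theta>_bij: "bij_betw \<theta> (carrier F) (carrier F)" using \<theta> by (simp add: iso_def)
    have basis: "is_basis F ?B"
      by (rule iso_imp_is_basis(1)) (use \<theta> in \<open>simp_all add: F_def group_free_group\<close>)
    have k: "length (?k (\<theta> w)) = length w" if "w \<in> carrier F" for w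
      using iso_imp_is_basis(2)[of F \<theta> A w] \<theta> that group_axioms by (simp add: F_def)
    have "prefix_dist F ?B \<in> visual_metrics F ?B \<one>\<^bsub>F\<^esub> 1 1"
      by (rule prefix_dist_visual[OF group_axioms basis])
    then have "lipschitz_condition (carrier F) (prefix_dist F ?B) \<phi>"
      using lip basis one_closed zero_less_one order_refl[of "1::real"] unfolding F_def by blast
    moreover have "?B \<noteq> {}" using assms(2) by auto
    ultimately obtain C where C: "\<And>g. g \<in> carrier F \<Longrightarrow> length (?k g) \<le> length (?k (\<phi> g)) + C"
      using lipschitz_condition_imp_length_le[OF group_axioms basis, of \<phi>] bij
      by (auto simp: bij_betw_def)
    have "length (inv_into (carrier F) \<theta> (\<psi> (\<theta> w))) \<le> length w + C" if w: "w \<in> carrier F" for w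
    proof -
      have \<theta>w: "\<theta> w \<in> carrier F" using \<theta>_bij w by (auto simp: bij_betw_def)
      then have g: "\<psi> (\<theta> w) \<in> carrier F" using \<psi>_bij by (auto simp: bij_betw_def)
      let ?x = "inv_into (carrier F) \<theta> (\<psi> (\<theta> w))"
      have x: "?x \<in> carrier F" "\<theta> ?x = \<psi> (\<theta> w)"
        using \<theta>_bij g by (auto simp: bij_betw_def inv_into_into f_inv_into_f)
      \<comment> \<open>The length bound is taken at \<open>\<psi> (\<theta> w)\<close>, where
        \<phi> undoes \<psi>; both lengths in the basis \<open>?B\<close> are then read off as
        lengths of preimages under \<theta>.\<close>
      show ?thesis using C[OF g] k[OF x(1)] k[OF w] x(2) \<phi>\<psi>[OF \<theta>w] by simp
    qed
    then show "\<exists>C. \<forall>w\<in>carrier F. length (inv_into (carrier F) \<theta> (\<psi> (\<theta> w))) \<le> length w + C"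
      by blast
  qed
  then obtain u where u: "u \<in> carrier F"
    "\<And>g. g \<in> carrier F \<Longrightarrow> \<psi> g = inv\<^bsub>F\<^esub> u \<otimes>\<^bsub>F\<^esub> g \<otimes>\<^bsub>F\<^esub> u"
    using stable_nonexpanding_imp_inner[of \<psi> A] \<psi> assms(2) unfolding F_def by blast
  \<comment> \<open>As \<psi> is conjugation by \<open>u\<close>, its inverse \<phi> is conjugation
    by the inverse of \<open>u\<close>.\<close>
  let ?a = "inv\<^bsub>F\<^esub> u"
  have "\<phi> g = inv\<^bsub>F\<^esub> ?a \<otimes>\<^bsub>F\<^esub> g \<otimes>\<^bsub>F\<^esub> ?a" if g: "g \<in> carrier F" for g
  proof -
    have "\<psi> (u \<otimes>\<^bsub>F\<^esub> g \<otimes>\<^bsub>F\<^esub> inv\<^bsub>F\<^esub> u) = g"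
      using u g by (simp add: cancel_simps)
    then show ?thesis using \<phi>\<psi>[of "u \<otimes>\<^bsub>F\<^esub> g \<otimes>\<^bsub>F\<^esub> inv\<^bsub>F\<^esub> u"] u(1) g by simp
  qed
  then have "\<phi> = (\<lambda>g\<in>carrier F. inv\<^bsub>F\<^esub> ?a \<otimes>\<^bsub>F\<^esub> g \<otimes>\<^bsub>F\<^esub> ?a)"
    using \<phi>(2) by (intro extensionalityI[of _ "carrier F"]) auto
  then show "\<phi> \<in> Inn (free_group A)"
    unfolding Inn_def F_def[symmetric] by (rule image_eqI) (simp add: u(1))
qed

end
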